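(* Let $n \geq 2$, let $H_1, \dots, H_n \subset \mathbb{R}^2$ be closed unit squares (side length $1$, arbitrary position and orientation), and let $\mathcal{H} = \bigcup_{i=1}^n H_i$. Suppose that $\mathcal{H}$ is an optimal counterexample, i.e. $$\frac{p(\mathcal{H})}{a(\mathcal{H})} > 4 \quad\text{and, for every } i \in \{1,\dots,n\},\quad \frac{p\left(\bigcup_{j \neq i} H_j\right)}{a\left(\bigcup_{j \neq i} H_j\right)} \leq 4.$$ Then for each $i \in \{1, \dots, n\}$, $$a\left(H_i \cap \bigcup_{j \neq i} H_j\right) > \frac{\pi}{4}.$$
   Context: Squares are filled (closed two-dimensional regions). For a closed, bounded polygonal figure $A \subset \mathbb{R}^2$, $p(A)$ denotes its perimeter (the total length of the boundary $\partial A$) and $a(A)$ denotes its area. The name "optimal counterexample" refers to the conjecture that the perimeter to area ratio of the union of finitely many unit squares in the plane does not exceed $4$; an optimal counterexample is a finite union of unit squares violating this bound such that removing any one of the component squares yields a union whose ratio is at most $4$. *)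

theory Defs
  imports "HOL-Analysis.Analysis"
begin

definition unit_square :: "(real^2) set \<Rightarrow> bool" where
  "unit_square S \<longleftrightarrow>
     (\<exists>c u v. norm u = 1 \<and> norm v = 1 \<and> u \<bullet> v = 0 \<and>
        S = {c + s *\<^sub>R u + t *\<^sub>R v | s t. 0 \<le> s \<and> s \<le> 1 \<and> 0 \<le> t \<and> t \<le> 1})"

text \<open>
  Length of a set is its one-dimensional Hausdorff measure. The covering sets are required to be
  bounded because the library's \<open>diameter\<close> is unspecified on unbounded sets.
\<close>

definition hausdorff1_pre :: "real \<Rightarrow> 'a::metric_space set \<Rightarrow> ennreal" where
  "hausdorff1_pre \<delta> A =
     (INF U \<in> {U :: nat \<Rightarrow> 'a set. A \<subseteq> (\<Union>k. U k) \<and> (\<forall>k. bounded (U k) \<and> diameter (U k) \<le> \<delta>)}.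
        \<Sum>k. ennreal (diameter (U k)))"

definition hausdorff1 :: "'a::metric_space set \<Rightarrow> ennreal" where
  "hausdorff1 A = (SUP \<delta> \<in> {0<..}. hausdorff1_pre \<delta> A)"

text \<open>
  The conversion to a real number maps \<open>\<infinity>\<close> to \<open>0\<close>; this is harmless for polygonal figures, whose
  boundary is a finite union of line segments and hence of finite length.
\<close>

definition perimeter :: "(real^2) set \<Rightarrow> real" where
  "perimeter A = enn2real (hausdorff1 (frontier A))"

definition area :: "(real^2) set \<Rightarrow> real" where
  "area A = measure lebesgue A"

definition optimal_counterexample :: "nat \<Rightarrow> (nat \<Rightarrow> (real^2) set) \<Rightarrow> bool" where
  "optimal_counterexample n H \<longleftrightarrow>
     perimeter (\<Union>i\<in>{1..n}. H i) / area (\<Union>i\<in>{1..n}. H i) > 4 \<and>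
     (\<forall>i\<in>{1..n}. perimeter (\<Union>j\<in>{1..n} - {i}. H j) / area (\<Union>j\<in>{1..n} - {i}. H j) \<le> 4)"

end

theory Submission
  imports Defs
begin

text \<open>
  Fix \<open>i\<close>, let \<open>A\<close> be the union of the other squares, \<open>B = H i\<close>, \<open>E = A \<union> B\<close> and
  \<open>C = A \<inter> B\<close>. The hypotheses give \<open>perimeter E > 4 * area E\<close>, \<open>perimeter A \<le> 4 * area A\<close> and
  \<open>perimeter B \<le> 4 * area B\<close>. Perimeter is submodular and area is modular, so \<open>C\<close> is a
  region with \<open>perimeter C < 4 * area C\<close>; by the isoperimetric inequality
  \<open>4 * pi * area C \<le> (perimeter C)\<^sup>2\<close> this forces \<open>pi < 4 * area C\<close>.

  The set \<open>C\<close> may contain segments and isolated points that bound no area, and these would be counted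
  by the Hausdorff measure of its frontier. The proof therefore never mentions the perimeter of \<open>C\<close>.
  It replaces perimeters by the growth of area under thickening: writing \<open>X\<^sub>r\<close> for the open
  \<open>r\<close>-neighbourhood of \<open>X\<close>, three facts suffice.

  \<^item> Inclusion-exclusion: \<open>E\<^sub>r = A\<^sub>r \<union> B\<^sub>r\<close> and \<open>C\<^sub>r \<subseteq> A\<^sub>r \<inter> B\<^sub>r\<close>,
    hence \<open>area C\<^sub>r + area E\<^sub>r \<le> area A\<^sub>r + area B\<^sub>r\<close>.

  \<^item> The Brunn-Minkowski inequality with a disc as one summand (\<open>sqrt_area_thicken_ge\<close>):
    \<open>area C\<^sub>r \<ge> (sqrt (area C) + r * sqrt pi)\<^sup>2 \<ge> area C + 2 * r * sqrt (pi * area C)\<close>.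

  \<^item> For a finite union \<open>X\<close> of squares, \<open>(area X\<^sub>r - area X) / r\<close> tends to the perimeter of \<open>X\<close>
    (\<open>outer_minkowski_content\<close>).

  Dividing by \<open>r\<close> and letting \<open>r\<close> tend to \<open>0\<close> gives
  \<open>perimeter E + 2 * sqrt (pi * area C) \<le> perimeter A + perimeter B\<close>
  (\<open>perimeter_Un_plus_isoperimetric_Int_le\<close>), and with the inequalities above
  \<open>2 * sqrt (pi * area C) < 4 * area C\<close>, which is the claim.

  The third fact rests on a description of the frontier that is stable under unions: apart from
  finitely many points, a frontier point of the figure is \<^emph>\<open>flat\<close>, meaning that near it the
  figure coincides with a half-plane, and only finitely many pairs of an outer normal and an offset
  occur. The flat points with a given normal and offset form a relatively open subset of a line.
  Both the Hausdorff measure of the frontier and the first-order growth of the area are equal to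
  the sum of the Lebesgue measures of these subsets.
\<close>

section \<open>Rectangles in an orthonormal frame\<close>

lemma orthonormal_expand:
  fixes u v x :: "real^2"
  assumes "norm u = 1" "norm v = 1" "u \<bullet> v = 0"
  shows "(x \<bullet> u) *\<^sub>R u + (x \<bullet> v) *\<^sub>R v = x"
proof -
  have "u \<noteq> v"
    using assms by (auto simp: norm_eq_1)
  have orth: "pairwise orthogonal {u, v}"
    using assms by (auto simp: pairwise_def orthogonal_def inner_commute)
  have "0 \<notin> {u, v}"
    using assms by auto
  then have "independent {u, v}"
    using orth by (rule pairwise_orthogonal_independent[rotated])
  then have "span {u, v} = (UNIV :: (real^2) set)"
    using \<open>u \<noteq> v\<close> card_ge_dim_independent[of "{u,v}" "UNIV :: (real^2) set"] by auto
  then have "(\<Sum>i\<in>{u, v}. (x \<bullet> i) *\<^sub>R i) = x"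
    using assms by (intro orthonormal_basis_expand[OF orth]) auto
  then show ?thesis
    using \<open>u \<noteq> v\<close> by simp
qed

lemma norm_orthonormal_combination:
  fixes u v :: "'a::real_inner"
  assumes "norm u = 1" "norm v = 1" "u \<bullet> v = 0"
  shows "(norm (s *\<^sub>R u + t *\<^sub>R v))\<^sup>2 = s\<^sup>2 + t\<^sup>2"
proof -
  have "u \<bullet> u = 1" "v \<bullet> v = 1" "v \<bullet> u = 0"
    using assms by (auto simp: norm_eq_1 inner_commute)
  then show ?thesis
    unfolding power2_norm_eq_inner
    using assms(3) by (simp add: inner_add_left inner_add_right power2_eq_square)
qed

text \<open>
  A product set in the coordinates given by \<open>u\<close> and \<open>v\<close>, which are meant to be orthonormal. The
  strips swept out by a side of a figure have this form, with a factor \<open>S\<close> that need not be an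
  interval.
\<close>

definition rectangle :: "real^2 \<Rightarrow> real^2 \<Rightarrow> real set \<Rightarrow> real set \<Rightarrow> (real^2) set" where
  "rectangle u v S T = {x. x \<bullet> u \<in> S \<and> x \<bullet> v \<in> T}"

lemma rectangle_borel:
  assumes "S \<in> sets borel" "T \<in> sets borel"
  shows "rectangle u v S T \<in> sets borel"
proof -
  have meas: "(\<lambda>x. x \<bullet> w) \<in> borel_measurable borel" for w :: "real^2"
    by simp
  have "(\<lambda>x. x \<bullet> u) -` S \<inter> space borel \<in> sets borel" "(\<lambda>x. x \<bullet> v) -` T \<inter> space borel \<in> sets borel"
    using assms by (intro measurable_sets[OF meas]; simp)+
  then have "((\<lambda>x. x \<bullet> u) -` S \<inter> space borel) \<inter> ((\<lambda>x. x \<bullet> v) -` T \<inter> space borel) \<in> sets borel"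
    by blast
  also have "((\<lambda>x. x \<bullet> u) -` S \<inter> space borel) \<inter> ((\<lambda>x. x \<bullet> v) -` T \<inter> space borel) = rectangle u v S T"
    by (auto simp: rectangle_def)
  finally show ?thesis .
qed

lemma bounded_rectangle:
  assumes uv: "norm u = 1" "norm v = 1" "u \<bullet> v = 0" and "bounded S" "bounded T"
  shows "bounded (rectangle u v S T)"
proof -
  obtain a b where a: "\<And>s. s \<in> S \<Longrightarrow> norm s \<le> a" and b: "\<And>t. t \<in> T \<Longrightarrow> norm t \<le> b"
    using assms by (auto simp: bounded_iff)
  have "norm x \<le> a + b" if "x \<in> rectangle u v S T" for x
  proof -
    have "norm x = norm ((x \<bullet> u) *\<^sub>R u + (x \<bullet> v) *\<^sub>R v)"
      by (simp add: orthonormal_expand[OF uv])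
    also have "\<dots> \<le> norm ((x \<bullet> u) *\<^sub>R u) + norm ((x \<bullet> v) *\<^sub>R v)"
      by (rule norm_triangle_ineq)
    also have "\<dots> \<le> a + b"
      using that a b uv by (intro add_mono) (auto simp: rectangle_def)
    finally show ?thesis .
  qed
  then show ?thesis
    by (auto simp: bounded_iff)
qed

text \<open>
  The indicator of the set is a product of functions of the single coordinates, so its integral
  factors.
\<close>

lemma emeasure_axis_rectangle:
  assumes "S \<in> sets borel" "T \<in> sets borel"
  shows "emeasure lborel (rectangle (axis 1 1) (axis 2 1) S T)
    = emeasure lborel S * emeasure lborel T"
proof -
  let ?e = "axis 1 1 :: real^2" and ?f = "axis 2 1 :: real^2"
  have ne: "?e \<noteq> ?f"
    by (simp add: axis_eq_axis)
  have Basis: "Basis = {?e, ?f}"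
    by (auto simp: Basis_vec_def UNIV_2)
  define A where "A b = (if b = ?e then S else T)" for b
  have "emeasure lborel (rectangle ?e ?f S T) = (\<integral>\<^sup>+x. indicator (rectangle ?e ?f S T) x \<partial>lborel)"
    using rectangle_borel[OF assms] by simp
  also have "\<dots> = (\<integral>\<^sup>+x. (\<Prod>b\<in>Basis. indicator (A b) (x \<bullet> b)) \<partial>lborel)"
    using ne by (intro nn_integral_cong) (auto simp: Basis A_def rectangle_def split: split_indicator)
  also have "\<dots> = (\<Prod>b\<in>Basis. \<integral>\<^sup>+x. indicator (A b) x \<partial>lborel)"
    using assms by (intro nn_integral_lborel_prod) (auto simp: A_def)
  also have "\<dots> = emeasure lborel S * emeasure lborel T"
    using ne assms by (simp add: Basis A_def)
  finally show ?thesis .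
qed

text \<open>
  The linear map that takes the standard basis to \<open>u\<close>, \<open>v\<close> is orthogonal and preserves Lebesgue
  measure, which reduces the claim to the axis-parallel case.
\<close>

lemma
  assumes uv: "norm u = 1" "norm v = 1" "u \<bullet> v = 0"
    and S: "S \<in> sets borel" "bounded S" and T: "T \<in> sets borel" "bounded T"
  shows lmeasurable_rectangle: "rectangle u v S T \<in> lmeasurable"
    and measure_rectangle: "measure lebesgue (rectangle u v S T) = measure lborel S * measure lborel T"
proof -
  define f :: "real^2 \<Rightarrow> real^2" where "f x = (x$1) *\<^sub>R u + (x$2) *\<^sub>R v" for x
  have uv': "u \<bullet> u = 1" "v \<bullet> v = 1" "v \<bullet> u = 0"
    using uv by (auto simp: norm_eq_1 inner_commute)
  have f: "orthogonal_transformation f"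
    unfolding orthogonal_transformation
  proof
    show "linear f"
      by (rule linearI) (auto simp: f_def algebra_simps)
    show "\<forall>x. norm (f x) = norm x"
    proof
      fix x
      have "(norm (f x))\<^sup>2 = (norm x)\<^sup>2"
        unfolding f_def norm_orthonormal_combination[OF uv]
        unfolding power2_norm_eq_inner by (simp add: inner_vec_def sum_2 power2_eq_square)
      then show "norm (f x) = norm x" by simp
    qed
  qed
  let ?R = "rectangle (axis 1 1) (axis 2 1) S T"
  have R: "?R = {x. x$1 \<in> S \<and> x$2 \<in> T}"
    by (auto simp: rectangle_def inner_axis)
  have img: "f ` ?R = rectangle u v S T"
  proof
    show "f ` ?R \<subseteq> rectangle u v S T"
      using uv uv' by (auto simp: R f_def rectangle_def inner_add_left inner_axis)
    show "rectangle u v S T \<subseteq> f ` ?R"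
    proof
      fix x assume x: "x \<in> rectangle u v S T"
      then have "x = f (vector [x \<bullet> u, x \<bullet> v])"
        using orthonormal_expand[OF uv, of x] by (simp add: f_def)
      then show "x \<in> f ` ?R"
        using x by (auto simp: R rectangle_def inner_axis intro!: image_eqI)
    qed
  qed
  have "bounded ?R" "?R \<in> sets borel"
    using S T by (auto intro!: rectangle_borel bounded_rectangle simp: inner_axis_axis)
  then have R_lm: "?R \<in> lmeasurable"
    by (intro bounded_set_imp_lmeasurable) auto
  show "rectangle u v S T \<in> lmeasurable"
    using measurable_orthogonal_image[OF f R_lm] by (simp add: img)
  have "measure lebesgue (rectangle u v S T) = measure lebesgue ?R"
    using measure_orthogonal_image[OF f R_lm] by (simp add: img)
  also have "\<dots> = measure lborel S * measure lborel T"
    using emeasure_axis_rectangle[OF S(1) T(1)] \<open>?R \<in> sets borel\<close>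
    by (simp add: measure_def enn2real_mult)
  finally show "measure lebesgue (rectangle u v S T) = measure lborel S * measure lborel T" .
qed

section \<open>One-dimensional Hausdorff measure of sets on lines\<close>

text \<open>
  The coverings that define the measure are sequences; covers indexed by an arbitrary
  countable set arise from subdivisions and from unions of two covers. Missing indices are filled with
  the empty set, whose diameter is \<open>0\<close>.
\<close>

lemma hausdorff1_pre_le_countable:
  assumes "countable I" "0 \<le> \<delta>" "A \<subseteq> (\<Union>i\<in>I. U i)"
    and U: "\<And>i. i \<in> I \<Longrightarrow> bounded (U i) \<and> diameter (U i) \<le> \<delta>"
  shows "hausdorff1_pre \<delta> A \<le> (\<integral>\<^sup>+i. ennreal (diameter (U i)) \<partial>count_space I)"
proof -
  let ?J = "to_nat_on I ` I"
  define W where "W n = (if n \<in> ?J then U (from_nat_into I n) else {})" for n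
  have W: "W (to_nat_on I i) = U i" if "i \<in> I" for i
    using that assms(1) by (auto simp: W_def)
  have "hausdorff1_pre \<delta> A \<le> (\<Sum>n. ennreal (diameter (W n)))"
    unfolding hausdorff1_pre_def
  proof (rule INF_lower, safe)
    fix x assume "x \<in> A"
    then obtain i where "i \<in> I" "x \<in> U i" using assms(3) by auto
    then show "x \<in> (\<Union>n. W n)" using W by auto
  next
    fix n
    show "bounded (W n)" "diameter (W n) \<le> \<delta>"
      using U assms(1,2) by (auto simp: W_def)
  qed
  also have "\<dots> = (\<integral>\<^sup>+n. ennreal (diameter (W n)) \<partial>count_space UNIV)"
    by (simp add: nn_integral_count_space_nat)
  also have "\<dots> = (\<integral>\<^sup>+n. ennreal (diameter (W n)) \<partial>count_space ?J)"
    by (rule nn_integral_count_space_eq) (auto simp: W_def)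
  also have "\<dots> = (\<integral>\<^sup>+i. ennreal (diameter (W (to_nat_on I i))) \<partial>count_space I)"
    using assms(1) by (intro nn_integral_bij_count_space[symmetric] inj_on_imp_bij_betw inj_on_to_nat_on)
  also have "\<dots> = (\<integral>\<^sup>+i. ennreal (diameter (U i)) \<partial>count_space I)"
    by (rule nn_integral_cong) (simp add: W)
  finally show ?thesis .
qed

lemma le_INF_add_INF:
  fixes f :: "'a \<Rightarrow> ennreal" and g :: "'b \<Rightarrow> ennreal"
  assumes *: "\<And>u w. \<lbrakk>u \<in> C; w \<in> D\<rbrakk> \<Longrightarrow> x \<le> f u + g w"
  shows "x \<le> (INF u\<in>C. f u) + (INF w\<in>D. g w)"
proof (rule ennreal_le_epsilon)
  fix e :: real assume e: "0 < e" and "(INF u\<in>C. f u) + (INF w\<in>D. g w) < top"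
  then have fin: "(INF u\<in>C. f u) < top" "(INF w\<in>D. g w) < top"
    by (auto simp: less_top)
  have pos: "0 < ennreal (e/2)" using e by simp
  have step: "a < a + ennreal (e/2)" if "a < top" for a :: ennreal
    using that pos ennreal_add_left_cancel_less[of a 0 "ennreal (e/2)"] by simp
  from step[OF fin(1)] step[OF fin(2)] obtain u w where uw: "u \<in> C" "f u < (INF u\<in>C. f u) + ennreal (e/2)"
      "w \<in> D" "g w < (INF w\<in>D. g w) + ennreal (e/2)"
    unfolding INF_less_iff by blast
  have "x \<le> f u + g w" using * uw by blast
  also have "\<dots> \<le> ((INF u\<in>C. f u) + ennreal (e/2)) + ((INF w\<in>D. g w) + ennreal (e/2))"
    using uw by (intro add_mono less_imp_le)
  also have "\<dots> = (INF u\<in>C. f u) + (INF w\<in>D. g w) + (ennreal (e/2) + ennreal (e/2))"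
    by (simp add: ac_simps)
  also have "ennreal (e/2) + ennreal (e/2) = ennreal e"
    using e by (simp add: ennreal_plus[symmetric] del: ennreal_plus)
  finally show "x \<le> (INF u\<in>C. f u) + (INF w\<in>D. g w) + ennreal e" .
qed

lemma hausdorff1_pre_Un:
  assumes "0 < \<delta>"
  shows "hausdorff1_pre \<delta> (A \<union> B) \<le> hausdorff1_pre \<delta> A + hausdorff1_pre \<delta> B"
proof -
  let ?C = "\<lambda>A. {U :: nat \<Rightarrow> 'a set. A \<subseteq> (\<Union>k. U k) \<and> (\<forall>k. bounded (U k) \<and> diameter (U k) \<le> \<delta>)}"
  let ?s = "\<lambda>U :: nat \<Rightarrow> 'a set. \<Sum>k. ennreal (diameter (U k))"
  have *: "hausdorff1_pre \<delta> (A \<union> B) \<le> ?s U + ?s W" if UW: "U \<in> ?C A" "W \<in> ?C B" for U W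
  proof -
    define X where "X i = (case i of Inl k \<Rightarrow> U k | Inr k \<Rightarrow> W k)" for i
    have cov: "A \<union> B \<subseteq> (\<Union>i\<in>UNIV. X i)"
    proof
      fix x assume "x \<in> A \<union> B"
      then obtain k where "x \<in> U k \<or> x \<in> W k" using UW by auto blast+
      then have "x \<in> X (Inl k) \<or> x \<in> X (Inr k)" by (auto simp: X_def)
      then show "x \<in> (\<Union>i\<in>UNIV. X i)" by auto
    qed
    have bd: "bounded (X i) \<and> diameter (X i) \<le> \<delta>" for i
      using that by (auto simp: X_def split: sum.split)
    have "hausdorff1_pre \<delta> (A \<union> B) \<le> (\<integral>\<^sup>+i. ennreal (diameter (X i)) \<partial>count_space UNIV)"
      using cov bd assms by (intro hausdorff1_pre_le_countable) auto
    also have "\<dots> = (\<integral>\<^sup>+i. (ennreal (diameter (X i)) * indicator (range Inl) i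
        + ennreal (diameter (X i)) * indicator (range Inr) i) \<partial>count_space UNIV)"
      by (rule nn_integral_cong) (auto split: split_indicator sum.split, metis UNIV_I image_eqI obj_sumE)
    also have "\<dots> = (\<integral>\<^sup>+i. ennreal (diameter (X i)) * indicator (range Inl) i \<partial>count_space UNIV)
        + (\<integral>\<^sup>+i. ennreal (diameter (X i)) * indicator (range Inr) i \<partial>count_space UNIV)"
      by (rule nn_integral_add) auto
    also have "(\<integral>\<^sup>+i. ennreal (diameter (X i)) * indicator (range Inl) i \<partial>count_space UNIV)
        = (\<integral>\<^sup>+i. ennreal (diameter (X i)) \<partial>count_space (range Inl))"
      by (simp add: nn_integral_count_space_indicator)
    also have "\<dots> = (\<integral>\<^sup>+k. ennreal (diameter (X (Inl k))) \<partial>count_space UNIV)"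
      by (rule nn_integral_bij_count_space[symmetric]) (auto intro: inj_on_imp_bij_betw)
    also have "\<dots> = ?s U"
      by (simp add: X_def nn_integral_count_space_nat)
    also have "(\<integral>\<^sup>+i. ennreal (diameter (X i)) * indicator (range Inr) i \<partial>count_space UNIV)
        = (\<integral>\<^sup>+i. ennreal (diameter (X i)) \<partial>count_space (range Inr))"
      by (simp add: nn_integral_count_space_indicator)
    also have "\<dots> = (\<integral>\<^sup>+k. ennreal (diameter (X (Inr k))) \<partial>count_space UNIV)"
      by (rule nn_integral_bij_count_space[symmetric]) (auto intro: inj_on_imp_bij_betw)
    also have "\<dots> = ?s W"
      by (simp add: X_def nn_integral_count_space_nat)
    finally show ?thesis .
  qed
  show ?thesis
    unfolding hausdorff1_pre_def[of _ A] hausdorff1_pre_def[of _ B] using * by (rule le_INF_add_INF)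
qed

lemma hausdorff1_pre_le: "0 < \<delta> \<Longrightarrow> hausdorff1_pre \<delta> A \<le> hausdorff1 A"
  unfolding hausdorff1_def by (rule SUP_upper) simp

lemma hausdorff1_Un: "hausdorff1 (A \<union> B) \<le> hausdorff1 A + hausdorff1 B"
  unfolding hausdorff1_def[of "A \<union> B"]
proof (rule SUP_least)
  fix \<delta> :: real assume "\<delta> \<in> {0<..}"
  then have "hausdorff1_pre \<delta> (A \<union> B) \<le> hausdorff1_pre \<delta> A + hausdorff1_pre \<delta> B"
    by (intro hausdorff1_pre_Un) auto
  also have "\<dots> \<le> hausdorff1 A + hausdorff1 B"
    using \<open>\<delta> \<in> {0<..}\<close> by (intro add_mono hausdorff1_pre_le) auto
  finally show "hausdorff1_pre \<delta> (A \<union> B) \<le> hausdorff1 A + hausdorff1 B" .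
qed

lemma hausdorff1_mono: "A \<subseteq> B \<Longrightarrow> hausdorff1 A \<le> hausdorff1 B"
  unfolding hausdorff1_def hausdorff1_pre_def by (intro SUP_mono' INF_superset_mono) auto

lemma hausdorff1_finite:
  assumes "finite A" shows "hausdorff1 A = 0"
proof -
  have "hausdorff1_pre \<delta> A \<le> 0" if "0 < \<delta>" for \<delta>
  proof -
    have "hausdorff1_pre \<delta> A \<le> (\<integral>\<^sup>+x. ennreal (diameter {x}) \<partial>count_space A)"
      using assms that by (intro hausdorff1_pre_le_countable) (auto intro: countable_finite)
    then show ?thesis by simp
  qed
  then show ?thesis unfolding hausdorff1_def by (simp add: SUP_eq_iff)
qed

lemma hausdorff1_UN:
  assumes "finite I"
  shows "hausdorff1 (\<Union>i\<in>I. A i) \<le> (\<Sum>i\<in>I. hausdorff1 (A i))"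
  using assms
proof (induction I)
  case empty
  then show ?case by (simp add: hausdorff1_finite)
next
  case (insert i I)
  have "hausdorff1 (\<Union>j\<in>insert i I. A j) \<le> hausdorff1 (A i) + hausdorff1 (\<Union>j\<in>I. A j)"
    using hausdorff1_Un by simp
  also have "\<dots> \<le> hausdorff1 (A i) + (\<Sum>i\<in>I. hausdorff1 (A i))"
    using insert by (intro add_left_mono)
  finally show ?case using insert by simp
qed

text \<open>
  An open set of reals is a countable union of non-overlapping intervals that can be taken as
  short as desired. The images of these intervals form an admissible cover, and its total diameter is at most
  their total length.
\<close>

lemma hausdorff1_Lipschitz_image_open:
  fixes \<phi> :: "real \<Rightarrow> 'a::metric_space"
  assumes lip: "\<And>x y. dist (\<phi> x) (\<phi> y) \<le> dist x y" and "open T" "bounded T"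
  shows "hausdorff1 (\<phi> ` T) \<le> emeasure lborel T"
  unfolding hausdorff1_def
proof (rule SUP_least)
  fix \<delta> :: real assume "\<delta> \<in> {0<..}"
  then have \<delta>: "0 < \<delta>" by simp
  obtain a where "T \<subseteq> cbox (-a) a"
    using bounded_subset_cbox_symmetric[OF \<open>bounded T\<close>] by metis
  then have T: "T \<subseteq> cbox (-\<bar>a\<bar> - 1) (\<bar>a\<bar> + 1)" by auto
  \<comment> \<open>This gauge makes the intervals of the covering lemma shorter than \<open>\<delta>\<close> and confines them to \<open>T\<close>.\<close>
  define g where "g x = (if x \<in> T then ball x (\<delta>/2) \<inter> T else ball x 1)" for x
  have g: "gauge g"
    using \<open>open T\<close> \<delta> by (auto simp: gauge_def g_def)
  obtain \<D> where \<D>: "countable \<D>"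
    "\<And>K. K \<in> \<D> \<Longrightarrow> interior K \<noteq> {} \<and> (\<exists>c d. K = cbox c d)"
    "pairwise (\<lambda>A B. interior A \<inter> interior B = {}) \<D>"
    "\<And>K. K \<in> \<D> \<Longrightarrow> \<exists>x \<in> T \<inter> K. K \<subseteq> g x" "T \<subseteq> \<Union>\<D>"
    by (rule covering_lemma[OF T _ g]) auto
  have sub: "\<exists>x. K \<subseteq> ball x (\<delta>/2) \<inter> T" if "K \<in> \<D>" for K
    using \<D>(4)[OF that] by (auto simp: g_def)
  have K: "bounded (\<phi> ` K) \<and> diameter (\<phi> ` K) \<le> \<delta> \<and>
    ennreal (diameter (\<phi> ` K)) \<le> emeasure lborel (interior K)" if K: "K \<in> \<D>" for K
  proof -
    obtain c d where cd: "K = {c..d}" "c < d"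
      using \<D>(2)[OF K] by auto
    obtain x where x: "K \<subseteq> ball x (\<delta>/2)"
      using sub[OF K] by auto
    have len: "d - c \<le> \<delta>"
    proof -
      have "c \<in> K" "d \<in> K"
        using cd by auto
      then have "c \<in> ball x (\<delta>/2)" "d \<in> ball x (\<delta>/2)"
        using x by auto
      then show ?thesis unfolding mem_ball dist_real_def by linarith
    qed
    have "dist (\<phi> s) (\<phi> t) \<le> d - c" if "s \<in> K" "t \<in> K" for s t
      using lip[of s t] that cd by (auto simp: dist_real_def)
    then have le: "\<forall>x\<in>\<phi> ` K. \<forall>y\<in>\<phi> ` K. dist x y \<le> d - c"
      by blast
    then have "bounded (\<phi> ` K)"
      unfolding bounded_two_points by blast
    moreover have "diameter (\<phi> ` K) \<le> d - c"
      using le cd by (auto simp: diameter_def intro!: cSUP_least)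
    ultimately show ?thesis
      using len cd by (auto intro!: ennreal_leI)
  qed
  have cov: "\<phi> ` T \<subseteq> (\<Union>K\<in>\<D>. \<phi> ` K)"
    using \<D>(5) by blast
  have "hausdorff1_pre \<delta> (\<phi> ` T) \<le> (\<integral>\<^sup>+K. ennreal (diameter (\<phi> ` K)) \<partial>count_space \<D>)"
    using \<D>(1) cov K \<delta> by (intro hausdorff1_pre_le_countable) auto
  also have "\<dots> \<le> (\<integral>\<^sup>+K. emeasure lborel (interior K) \<partial>count_space \<D>)"
    using K by (intro nn_integral_mono) auto
  also have "\<dots> = emeasure lborel (\<Union>K\<in>\<D>. interior K)"
    using \<D>(1,3) by (intro emeasure_UN_countable[symmetric]) (auto simp: disjoint_family_on_def pairwise_def)
  also have "\<dots> \<le> emeasure lborel T"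
    using sub interior_subset \<open>open T\<close> by (intro emeasure_mono) (auto, blast)
  finally show "hausdorff1_pre \<delta> (\<phi> ` T) \<le> emeasure lborel T" .
qed

lemma separate_finitely_many_compacts:
  fixes K :: "'i \<Rightarrow> 'a::heine_borel set"
  assumes "finite I" "\<And>i. i \<in> I \<Longrightarrow> compact (K i)" "disjoint_family_on K I"
  obtains \<delta> where "0 < \<delta>"
    "\<And>i j x y. \<lbrakk>i \<in> I; j \<in> I; i \<noteq> j; x \<in> K i; y \<in> K j\<rbrakk> \<Longrightarrow> \<delta> \<le> dist x y"
proof -
  define P where "P = {(i, j) \<in> I \<times> I. i \<noteq> j}"
  have "\<exists>d. 0 < d \<and> (\<forall>x\<in>K (fst p). \<forall>y\<in>K (snd p). d \<le> dist x y)" if "p \<in> P" for p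
  proof -
    have "fst p \<in> I" "snd p \<in> I" "fst p \<noteq> snd p"
      using that by (auto simp: P_def)
    then have "compact (K (fst p))" "closed (K (snd p))" "K (fst p) \<inter> K (snd p) = {}"
      using assms(2,3) by (auto simp: disjoint_family_on_def intro: compact_imp_closed)
    then show ?thesis
      using separate_compact_closed by blast
  qed
  then have "\<forall>p\<in>P. \<exists>d. 0 < d \<and> (\<forall>x\<in>K (fst p). \<forall>y\<in>K (snd p). d \<le> dist x y)"
    by blast
  then obtain d where d: "\<And>p. p \<in> P \<Longrightarrow> 0 < d p \<and> (\<forall>x\<in>K (fst p). \<forall>y\<in>K (snd p). d p \<le> dist x y)"
    using bchoice[of P "\<lambda>p d. 0 < d \<and> (\<forall>x\<in>K (fst p). \<forall>y\<in>K (snd p). d \<le> dist x y)"] by blast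
  have fin: "finite (insert 1 (d ` P))"
    using \<open>finite I\<close> by (auto simp: P_def intro: finite_subset[of _ "I \<times> I"])
  show thesis
  proof
    show "0 < Min (insert 1 (d ` P))"
      using fin d by auto
    fix i j x y assume "i \<in> I" "j \<in> I" "i \<noteq> j" "x \<in> K i" "y \<in> K j"
    then have "(i, j) \<in> P" by (simp add: P_def)
    then have "Min (insert 1 (d ` P)) \<le> d (i, j)"
      using fin by (intro Min_le) auto
    also have "\<dots> \<le> dist x y"
      using d[OF \<open>(i, j) \<in> P\<close>] \<open>x \<in> K i\<close> \<open>y \<in> K j\<close> by auto
    finally show "Min (insert 1 (d ` P)) \<le> dist x y" .
  qed
qed

text \<open>
  The closed interval from the infimum to the supremum.
\<close>

lemma bounded_real_hull:
  fixes X :: "real set"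
  assumes "bounded X"
  obtains C where "C \<in> sets borel" "X \<subseteq> C" "emeasure lborel C \<le> ennreal (diameter X)"
    "X = {} \<Longrightarrow> C = {}"
proof (cases "X = {}")
  case True
  then show ?thesis by (intro that[of "{}"]) auto
next
  case False
  have bd: "bdd_above X" "bdd_below X"
    using assms by (auto simp: bounded_imp_bdd_above bounded_imp_bdd_below)
  have "Sup X \<le> Inf X + diameter X"
  proof (rule cSup_least[OF False])
    fix x assume x: "x \<in> X"
    have "x - diameter X \<le> Inf X"
    proof (rule cInf_greatest[OF False])
      fix y assume "y \<in> X"
      then have "dist x y \<le> diameter X"
        by (rule diameter_bounded_bound[OF assms x])
      then show "x - diameter X \<le> y"
        by (simp add: dist_real_def)
    qed
    then show "x \<le> Inf X + diameter X" by simp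
  qed
  moreover have "Inf X \<le> Sup X"
    using False bd by (metis cInf_le_cSup)
  ultimately show ?thesis
    using False bd
    by (intro that[of "{Inf X..Sup X}"]) (auto intro!: cInf_lower cSup_upper ennreal_leI)
qed

lemma sum_le_if_at_most_one_nonzero:
  fixes f :: "'i \<Rightarrow> ennreal"
  assumes "finite I" "\<And>i. i \<in> I \<Longrightarrow> f i \<le> b"
    and one: "\<And>i j. \<lbrakk>i \<in> I; j \<in> I; f i \<noteq> 0; f j \<noteq> 0\<rbrakk> \<Longrightarrow> i = j"
  shows "sum f I \<le> b"
proof (cases "\<exists>i\<in>I. f i \<noteq> 0")
  case True
  then obtain i where i: "i \<in> I" "f i \<noteq> 0" by blast
  have "sum f I = sum f {i}"
    using assms(1) i one by (intro sum.mono_neutral_right) auto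
  then show ?thesis using assms(2)[OF i(1)] by simp
qed auto

text \<open>
  Compact pieces that are pairwise disjoint have a positive distance \<open>\<delta>\<close>, so a covering set of
  diameter at most \<open>\<delta>/2\<close> meets at most one piece, and the part of this piece that it covers lies in
  an interval of the same length. Hence the diameters of a fine cover add up to at least the sum of
  the lengths of the pieces. This replaces the additivity of Hausdorff measure on Borel sets.
\<close>

lemma sum_lengths_le_hausdorff1:
  fixes \<phi> :: "'i \<Rightarrow> real \<Rightarrow> 'a::heine_borel"
  assumes "finite I"
    and iso: "\<And>i x y. i \<in> I \<Longrightarrow> dist (\<phi> i x) (\<phi> i y) = dist x y"
    and K: "\<And>i. i \<in> I \<Longrightarrow> compact (K i)"
    and disj: "disjoint_family_on (\<lambda>i. \<phi> i ` K i) I"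
    and sub: "\<And>i. i \<in> I \<Longrightarrow> \<phi> i ` K i \<subseteq> A"
  shows "(\<Sum>i\<in>I. emeasure lborel (K i)) \<le> hausdorff1 A"
proof -
  have cont: "continuous_on S (\<phi> i)" if "i \<in> I" for i S
    unfolding continuous_on_iff using iso[OF that] by auto
  have cpt: "compact (\<phi> i ` K i)" if "i \<in> I" for i
    using cont[OF that] K[OF that] by (rule compact_continuous_image)
  obtain \<delta> where \<delta>: "0 < \<delta>"
    "\<And>i j x y. \<lbrakk>i \<in> I; j \<in> I; i \<noteq> j; x \<in> \<phi> i ` K i; y \<in> \<phi> j ` K j\<rbrakk> \<Longrightarrow> \<delta> \<le> dist x y"
    by (rule separate_finitely_many_compacts[OF \<open>finite I\<close> cpt disj]) blast+
  have "(\<Sum>i\<in>I. emeasure lborel (K i)) \<le> hausdorff1_pre (\<delta>/2) A"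
    unfolding hausdorff1_pre_def
  proof (rule INF_greatest)
    fix U :: "nat \<Rightarrow> 'a set"
    assume "U \<in> {U. A \<subseteq> (\<Union>k. U k) \<and> (\<forall>k. bounded (U k) \<and> diameter (U k) \<le> \<delta>/2)}"
    then have cov: "A \<subseteq> (\<Union>k. U k)" and U: "\<And>k. bounded (U k)" "\<And>k. diameter (U k) \<le> \<delta>/2"
      by auto
    define J where "J i k = {t \<in> K i. \<phi> i t \<in> U k}" for i k
    have J: "bounded (J i k)" "diameter (J i k) \<le> diameter (U k)" if "i \<in> I" for i k
    proof -
      show "bounded (J i k)"
        using compact_imp_bounded[OF K[OF that]] by (rule bounded_subset) (auto simp: J_def)
      show "diameter (J i k) \<le> diameter (U k)"
      proof (rule diameter_le)
        show "J i k \<noteq> {} \<or> 0 \<le> diameter (U k)"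
          using diameter_ge_0[OF U(1)] by simp
        fix s t assume "s \<in> J i k" "t \<in> J i k"
        then show "norm (s - t) \<le> diameter (U k)"
          using diameter_bounded_bound[OF U(1), of "\<phi> i s" k "\<phi> i t"] iso[OF that, of s t]
          by (auto simp: J_def dist_norm)
      qed
    qed
    let ?hull = "\<lambda>X C. C \<in> sets borel \<and> X \<subseteq> C \<and> emeasure lborel C \<le> ennreal (diameter X) \<and>
      (X = {} \<longrightarrow> C = {})"
    define C where "C i k = (SOME C. ?hull (J i k) C)" for i k
    have hull: "?hull (J i k) (C i k)" if i: "i \<in> I" for i k
      unfolding C_def
    proof (rule someI_ex)
      obtain D where "D \<in> sets borel" "J i k \<subseteq> D" "emeasure lborel D \<le> ennreal (diameter (J i k))"
        "J i k = {} \<Longrightarrow> D = {}"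
        by (rule bounded_real_hull[OF J(1)[OF i, of k]]) blast
      then show "\<exists>D. ?hull (J i k) D" by blast
    qed
    have C: "C i k \<in> sets borel" "J i k \<subseteq> C i k" "J i k = {} \<Longrightarrow> C i k = {}"
      "emeasure lborel (C i k) \<le> ennreal (diameter (U k))" if i: "i \<in> I" for i k
      using hull[OF i, of k] ennreal_leI[OF J(2)[OF i, of k]] by (blast intro: order_trans)+
    have "(\<Sum>i\<in>I. emeasure lborel (K i)) \<le> (\<Sum>i\<in>I. \<Sum>k. emeasure lborel (C i k))"
    proof (rule sum_mono)
      fix i assume i: "i \<in> I"
      have "K i \<subseteq> (\<Union>k. C i k)"
      proof
        fix t assume "t \<in> K i"
        then obtain k where "\<phi> i t \<in> U k" using sub[OF i] cov by blast
        then have "t \<in> J i k" using \<open>t \<in> K i\<close> by (simp add: J_def)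
        then show "t \<in> (\<Union>k. C i k)" using C(2)[OF i] by blast
      qed
      then have "emeasure lborel (K i) \<le> emeasure lborel (\<Union>k. C i k)"
        using C(1)[OF i] by (intro emeasure_mono) auto
      also have "\<dots> \<le> (\<Sum>k. emeasure lborel (C i k))"
        using C(1)[OF i] by (intro emeasure_subadditive_countably) auto
      finally show "emeasure lborel (K i) \<le> (\<Sum>k. emeasure lborel (C i k))" .
    qed
    also have "\<dots> = (\<Sum>k. \<Sum>i\<in>I. emeasure lborel (C i k))"
      by (rule suminf_sum[symmetric]) simp
    also have "\<dots> \<le> (\<Sum>k. ennreal (diameter (U k)))"
    proof (rule suminf_le)
      fix k
      show "(\<Sum>i\<in>I. emeasure lborel (C i k)) \<le> ennreal (diameter (U k))"
      proof (rule sum_le_if_at_most_one_nonzero[OF \<open>finite I\<close>])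
        fix i j assume ij: "i \<in> I" "j \<in> I" "emeasure lborel (C i k) \<noteq> 0" "emeasure lborel (C j k) \<noteq> 0"
        then have "J i k \<noteq> {}" "J j k \<noteq> {}" using C(3) by force+
        then obtain s t where st: "s \<in> K i" "\<phi> i s \<in> U k" "t \<in> K j" "\<phi> j t \<in> U k"
          by (auto simp: J_def)
        then have "dist (\<phi> i s) (\<phi> j t) \<le> \<delta>/2"
          using diameter_bounded_bound[OF U(1) st(2,4)] U(2)[of k] by simp
        then show "i = j"
          using \<delta>(2)[OF ij(1,2)] \<delta>(1) st by fastforce
      qed (use C(4) in auto)
    qed auto
    finally show "(\<Sum>i\<in>I. emeasure lborel (K i)) \<le> (\<Sum>k. ennreal (diameter (U k)))" .
  qed
  also have "\<dots> \<le> hausdorff1 A"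
    using \<delta>(1) by (intro hausdorff1_pre_le) simp
  finally show ?thesis .
qed

section \<open>Flat boundary points\<close>

definition quarter_turn :: "real^2 \<Rightarrow> real^2" where
  "quarter_turn x = vector [- (x$2), x$1]"

lemma norm_quarter_turn: "norm (quarter_turn x) = norm x"
  by (simp add: quarter_turn_def norm_eq_sqrt_inner inner_vec_def sum_2 add.commute)

lemma inner_quarter_turn: "quarter_turn x \<bullet> x = 0" "x \<bullet> quarter_turn x = 0"
  by (simp_all add: quarter_turn_def inner_vec_def sum_2)

text \<open>
  Near \<open>y\<close> the set \<open>E\<close> is the closed half-plane with outer unit normal \<open>\<nu>\<close>. Being flat is a local
  property, which is what makes it compatible with unions.
\<close>

definition flat_at :: "(real^2) set \<Rightarrow> real^2 \<Rightarrow> real^2 \<Rightarrow> bool" where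
  "flat_at E \<nu> y \<longleftrightarrow> norm \<nu> = 1 \<and> (\<exists>\<rho>>0. \<forall>z\<in>ball y \<rho>. z \<in> E \<longleftrightarrow> (z - y) \<bullet> \<nu> \<le> 0)"

text \<open>
  The rays from \<open>y\<close> that start inside \<open>E\<close> are those with direction in the half-plane; flat points enter
  the following arguments mostly in this form.
\<close>

lemma flat_at_cone:
  assumes "flat_at E \<nu> y"
  obtains \<epsilon> where "0 < \<epsilon>" "\<And>t. \<lbrakk>0 < t; t \<le> \<epsilon>\<rbrakk> \<Longrightarrow> y + t *\<^sub>R q \<in> E \<longleftrightarrow> q \<bullet> \<nu> \<le> 0"
proof -
  obtain \<rho> where \<rho>: "0 < \<rho>" "\<And>z. z \<in> ball y \<rho> \<Longrightarrow> z \<in> E \<longleftrightarrow> (z - y) \<bullet> \<nu> \<le> 0"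
    using assms by (auto simp: flat_at_def)
  have pos: "0 < norm q + 1" by (simp add: add_nonneg_pos)
  show thesis
  proof
    show "0 < \<rho> / (norm q + 1)" using \<rho>(1) pos by simp
    fix t assume t: "0 < t" "t \<le> \<rho> / (norm q + 1)"
    have "t * norm q < t * (norm q + 1)" using t by simp
    also have "\<dots> \<le> \<rho>" using t pos by (simp add: field_simps)
    finally have "y + t *\<^sub>R q \<in> ball y \<rho>" using t by (simp add: dist_norm)
    from \<rho>(2)[OF this] show "y + t *\<^sub>R q \<in> E \<longleftrightarrow> q \<bullet> \<nu> \<le> 0"
      using t by (simp add: mult_le_0_iff)
  qed
qed

lemma flat_at_mem: "flat_at E \<nu> y \<Longrightarrow> y \<in> E"
  unfolding flat_at_def by force

text \<open>
  If the normals differed, the direction \<open>\<nu> - \<mu>\<close> would point out of the half-plane of \<open>\<nu>\<close> and into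
  that of \<open>\<mu>\<close>.
\<close>

lemma flat_at_normal_unique:
  assumes "flat_at E \<nu> y" "flat_at E \<mu> y"
  shows "\<nu> = \<mu>"
proof -
  have n: "\<nu> \<bullet> \<nu> = 1" "\<mu> \<bullet> \<mu> = 1"
    using assms by (auto simp: flat_at_def norm_eq_1)
  obtain a where a: "0 < a" "\<And>t. \<lbrakk>0 < t; t \<le> a\<rbrakk> \<Longrightarrow> y + t *\<^sub>R (\<nu> - \<mu>) \<in> E \<longleftrightarrow> (\<nu> - \<mu>) \<bullet> \<nu> \<le> 0"
    using flat_at_cone[OF assms(1)] by metis
  obtain b where b: "0 < b" "\<And>t. \<lbrakk>0 < t; t \<le> b\<rbrakk> \<Longrightarrow> y + t *\<^sub>R (\<nu> - \<mu>) \<in> E \<longleftrightarrow> (\<nu> - \<mu>) \<bullet> \<mu> \<le> 0"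
    using flat_at_cone[OF assms(2)] by metis
  have "(\<nu> - \<mu>) \<bullet> \<nu> \<le> 0 \<longleftrightarrow> (\<nu> - \<mu>) \<bullet> \<mu> \<le> 0"
    using a(2)[of "min a b"] b(2)[of "min a b"] a(1) b(1) by simp
  moreover have "\<nu> \<bullet> \<mu> \<le> 1"
    using norm_cauchy_schwarz[of \<nu> \<mu>] assms by (simp add: flat_at_def)
  moreover have comm: "\<mu> \<bullet> \<nu> = \<nu> \<bullet> \<mu>"
    by (rule inner_commute)
  ultimately have "\<nu> \<bullet> \<mu> = 1"
    using n by (auto simp: inner_diff_left)
  then have "(\<nu> - \<mu>) \<bullet> (\<nu> - \<mu>) = 0"
    using n comm by (simp add: inner_diff_left inner_diff_right)
  then show ?thesis by simp
qed

lemma flat_at_frontier: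
  assumes "flat_at E \<nu> y"
  shows "y \<in> frontier E"
proof -
  have "y \<notin> interior E"
  proof
    assume "y \<in> interior E"
    then obtain e where e: "0 < e" "cball y e \<subseteq> E"
      by (meson mem_interior_cball)
    obtain a where a: "0 < a" "\<And>t. \<lbrakk>0 < t; t \<le> a\<rbrakk> \<Longrightarrow> y + t *\<^sub>R \<nu> \<in> E \<longleftrightarrow> \<nu> \<bullet> \<nu> \<le> 0"
      using flat_at_cone[OF assms] by metis
    have "norm \<nu> = 1" "\<nu> \<bullet> \<nu> = 1" using assms by (auto simp: flat_at_def norm_eq_1)
    then have "y + min a e *\<^sub>R \<nu> \<in> cball y e"
      using a(1) e(1) by (simp add: dist_norm)
    then show False
      using a(2)[of "min a e"] a(1) e \<open>\<nu> \<bullet> \<nu> = 1\<close> by auto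
  qed
  then show ?thesis
    using flat_at_mem[OF assms] closure_subset by (auto simp: frontier_def)
qed

text \<open>
  A pair \<open>p = (\<nu>, h)\<close> with a unit vector \<open>\<nu>\<close> stands for the line \<open>y \<bullet> \<nu> = h\<close> with a chosen normal;
  this function parametrizes the line by arc length.
\<close>

definition on_line :: "(real^2) \<times> real \<Rightarrow> real \<Rightarrow> real^2" where
  "on_line p t = t *\<^sub>R quarter_turn (fst p) + snd p *\<^sub>R fst p"

text \<open>
  The parameters of the flat points with normal and offset \<open>p\<close>. Several collinear edges of a figure
  contribute to one and the same side, and the two orientations of a line give different sides.
\<close>

definition side :: "(real^2) set \<Rightarrow> (real^2) \<times> real \<Rightarrow> real set" where
  "side E p = {t. flat_at E (fst p) (on_line p t)}"

lemma dist_on_line: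
  assumes "norm (fst p) = 1"
  shows "dist (on_line p s) (on_line p t) = dist s t"
proof -
  have "on_line p s - on_line p t = (s - t) *\<^sub>R quarter_turn (fst p)"
    by (simp add: on_line_def algebra_simps)
  then show ?thesis
    using assms by (simp add: dist_norm norm_quarter_turn)
qed

lemma on_line_inner:
  assumes "norm (fst p) = 1"
  shows "on_line p t \<bullet> fst p = snd p" "on_line p t \<bullet> quarter_turn (fst p) = t"
proof -
  have *: "fst p \<bullet> fst p = 1" "quarter_turn (fst p) \<bullet> quarter_turn (fst p) = 1"
    using assms by (auto simp: norm_eq_1[symmetric] norm_quarter_turn)
  show "on_line p t \<bullet> fst p = snd p" "on_line p t \<bullet> quarter_turn (fst p) = t"
    using inner_quarter_turn[of "fst p"] *
    by (simp_all add: on_line_def inner_add_left)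
qed

lemma rectangle_point:
  assumes "norm (fst p) = 1"
  shows "x = on_line p (x \<bullet> quarter_turn (fst p)) + (x \<bullet> fst p - snd p) *\<^sub>R fst p"
proof -
  have "(x \<bullet> quarter_turn (fst p)) *\<^sub>R quarter_turn (fst p) + (x \<bullet> fst p) *\<^sub>R fst p = x"
    using assms by (intro orthonormal_expand) (auto simp: norm_quarter_turn inner_quarter_turn)
  then show ?thesis
    by (simp add: on_line_def algebra_simps)
qed

lemma on_line_inner_self:
  assumes "norm (fst p) = 1" "y \<bullet> fst p = snd p"
  shows "y = on_line p (y \<bullet> quarter_turn (fst p))"
  using rectangle_point[OF assms(1), of y] assms(2) by simp

text \<open>
  Moving a flat point along its line, within the ball in which the figure is a half-plane, yields flat
  points with the same normal.
\<close>

lemma open_side: "open (side E p)"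
proof (cases "norm (fst p) = 1")
  case False
  then have "side E p = {}" by (auto simp: side_def flat_at_def)
  then show ?thesis by simp
next
  case p: True
  show ?thesis
    unfolding open_dist
  proof
    fix t assume "t \<in> side E p"
    then obtain \<rho> where \<rho>: "0 < \<rho>"
      "\<And>z. z \<in> ball (on_line p t) \<rho> \<Longrightarrow> z \<in> E \<longleftrightarrow> (z - on_line p t) \<bullet> fst p \<le> 0"
      by (auto simp: side_def flat_at_def)
    have "s \<in> side E p" if s: "dist s t < \<rho>/2" for s
    proof -
      have "z \<in> E \<longleftrightarrow> (z - on_line p s) \<bullet> fst p \<le> 0" if z: "z \<in> ball (on_line p s) (\<rho>/2)" for z
      proof -
        have "dist (on_line p t) z \<le> dist (on_line p t) (on_line p s) + dist (on_line p s) z"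
          by (rule dist_triangle)
        then have "z \<in> ball (on_line p t) \<rho>"
          using s z dist_on_line[OF p, of t s] by (simp add: dist_commute)
        then show ?thesis
          using \<rho>(2) by (simp add: inner_diff_left on_line_inner[OF p])
      qed
      then show ?thesis
        using \<rho>(1) p unfolding side_def flat_at_def by (auto intro!: exI[of _ "\<rho>/2"])
    qed
    then show "\<exists>e>0. \<forall>s. dist s t < e \<longrightarrow> s \<in> side E p"
      using \<rho>(1) by (intro exI[of _ "\<rho>/2"]) auto
  qed
qed

lemma bounded_side:
  assumes "bounded E" shows "bounded (side E p)"
proof (cases "norm (fst p) = 1")
  case False
  then have "side E p = {}" by (auto simp: side_def flat_at_def)
  then show ?thesis by simp
next
  case p: True
  obtain B where B: "\<And>x. x \<in> E \<Longrightarrow> norm x \<le> B"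
    using assms by (auto simp: bounded_iff)
  have "norm t \<le> B" if "t \<in> side E p" for t
  proof -
    have "norm (on_line p t) \<le> B"
      using that by (intro B flat_at_mem) (auto simp: side_def)
    moreover have "\<bar>t\<bar> \<le> norm (on_line p t)"
      using Cauchy_Schwarz_ineq2[of "on_line p t" "quarter_turn (fst p)"] on_line_inner(2)[OF p, of t]
      by (simp add: norm_quarter_turn p)
    ultimately show ?thesis by simp
  qed
  then show ?thesis by (auto simp: bounded_iff)
qed

text \<open>
  First-order optimality: moving the nearest point \<open>y\<close> of \<open>E\<close> in a direction \<open>q\<close> that stays
  in \<open>E\<close> cannot decrease the distance to \<open>x\<close>.
\<close>

lemma nearest_point_direction:
  fixes E :: "'a::real_inner set"
  assumes near: "\<And>z. z \<in> E \<Longrightarrow> dist x y \<le> dist x z"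
    and "0 < \<epsilon>" and cone: "\<And>t. \<lbrakk>0 < t; t \<le> \<epsilon>\<rbrakk> \<Longrightarrow> y + t *\<^sub>R q \<in> E"
  shows "(x - y) \<bullet> q \<le> 0"
proof (rule ccontr)
  assume "\<not> (x - y) \<bullet> q \<le> 0"
  then have pos: "0 < (x - y) \<bullet> q" by simp
  then have q: "0 < q \<bullet> q" by (metis inner_gt_zero_iff inner_zero_right less_irrefl)
  \<comment> \<open>The unconstrained minimum of the squared distance along the ray, truncated to \<open>\<epsilon>\<close>.\<close>
  define t where "t = min \<epsilon> ((x - y) \<bullet> q / (q \<bullet> q))"
  have t: "0 < t" "t \<le> \<epsilon>" "t * (q \<bullet> q) \<le> (x - y) \<bullet> q"
    using \<open>0 < \<epsilon>\<close> pos q by (auto simp: t_def min_def field_simps)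
  have "dist x y \<le> dist x (y + t *\<^sub>R q)"
    using near cone t by blast
  then have "(x - y) \<bullet> (x - y) \<le> (x - y - t *\<^sub>R q) \<bullet> (x - y - t *\<^sub>R q)"
    by (simp add: dist_norm norm_le diff_diff_eq)
  also have "\<dots> = (x - y) \<bullet> (x - y) - 2 * t * ((x - y) \<bullet> q) + t * (t * (q \<bullet> q))"
    by (simp add: inner_diff_left inner_diff_right inner_commute algebra_simps)
  also have "t * (t * (q \<bullet> q)) \<le> t * ((x - y) \<bullet> q)"
    using t by (intro mult_left_mono) auto
  finally have "t * ((x - y) \<bullet> q) \<le> 0" by simp
  then show False using t pos by (simp add: mult_le_0_iff)
qed

text \<open>
  The vector \<open>x - y\<close> makes no acute angle with any direction of the half-plane, hence it is a
  nonnegative multiple of the outer normal.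
\<close>

lemma nearest_point_flat:
  assumes near: "\<And>z. z \<in> E \<Longrightarrow> dist x y \<le> dist x z" and flat: "flat_at E \<nu> y"
  shows "x = y + dist x y *\<^sub>R \<nu>"
proof -
  have \<nu>: "\<nu> \<bullet> \<nu> = 1" using flat by (simp add: flat_at_def norm_eq_1)
  have dir: "(x - y) \<bullet> q \<le> 0" if "q \<bullet> \<nu> \<le> 0" for q
    using flat_at_cone[OF flat, of q] nearest_point_direction[OF near] that by metis
  define c where "c = (x - y) \<bullet> \<nu>"
  have "(x - y - c *\<^sub>R \<nu>) \<bullet> \<nu> = 0"
    using \<nu> by (simp add: c_def inner_diff_left)
  moreover from this have "(x - y) \<bullet> (x - y - c *\<^sub>R \<nu>) \<le> 0"
    by (intro dir) simp
  ultimately have "(x - y - c *\<^sub>R \<nu>) \<bullet> (x - y - c *\<^sub>R \<nu>) \<le> 0"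
    by (simp add: inner_diff_left[of "x - y"] inner_commute)
  then have eq: "x - y = c *\<^sub>R \<nu>"
    by (metis inner_eq_zero_iff inner_ge_zero order_antisym eq_iff_diff_eq_0)
  have "0 \<le> c"
    using dir[of "- \<nu>"] \<nu> by (simp add: c_def)
  then have "dist x y = c"
    using eq flat by (simp add: dist_norm flat_at_def)
  then show ?thesis using eq by (simp add: algebra_simps)
qed

section \<open>Perimeter as outer Minkowski content\<close>

definition thicken :: "real \<Rightarrow> (real^2) set \<Rightarrow> (real^2) set" where
  "thicken r E = (\<Union>x\<in>E. ball x r)"

lemma open_thicken: "open (thicken r E)"
  by (auto simp: thicken_def)

lemma bounded_thicken:
  assumes "bounded E" shows "bounded (thicken r E)"
proof -
  obtain B where B: "\<And>x. x \<in> E \<Longrightarrow> norm x \<le> B"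
    using assms by (auto simp: bounded_iff)
  have "norm z \<le> B + r" if z: "z \<in> thicken r E" for z
  proof -
    obtain x where x: "x \<in> E" "dist x z < r"
      using z by (auto simp: thicken_def)
    have "norm z \<le> norm x + norm (z - x)" by (metis add.commute diff_add_cancel norm_triangle_ineq)
    then show ?thesis using B[OF x(1)] x(2) by (simp add: dist_norm norm_minus_commute)
  qed
  then show ?thesis by (auto simp: bounded_iff)
qed

lemma lmeasurable_thicken: "bounded E \<Longrightarrow> thicken r E \<in> lmeasurable"
  by (intro lmeasurable_open bounded_thicken open_thicken)

lemma subset_thicken: "0 < r \<Longrightarrow> E \<subseteq> thicken r E"
  by (auto simp: thicken_def)

text \<open>
  \<open>V\<close> collects the exceptional frontier points such as corners, and \<open>N\<close> the oriented lines that carry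
  the sides. Neither set is required to be minimal: \<open>V\<close> may contain flat points and \<open>N\<close> may contain
  lines with an empty side. The condition excludes one-dimensional parts of \<open>E\<close>, such as a segment
  that sticks out, where the growth of area would count both sides.
\<close>

locale polygonal_figure =
  fixes E :: "(real^2) set" and V :: "(real^2) set" and N :: "((real^2) \<times> real) set"
  assumes compact_E: "compact E" and finite_V: "finite V" and finite_N: "finite N"
    and unit_normal: "p \<in> N \<Longrightarrow> norm (fst p) = 1"
    and frontier_flat: "y \<in> frontier E \<Longrightarrow> y \<in> V \<or> (\<exists>p\<in>N. flat_at E (fst p) y \<and> y \<bullet> fst p = snd p)"
begin

definition "total_side_length = (\<Sum>p\<in>N. measure lborel (side E p))"

lemma side_borel: "side E p \<in> sets borel"
  by (intro borel_open open_side)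

lemma bounded_E: "bounded E" and closed_E: "closed E"
  using compact_E by (auto intro: compact_imp_bounded compact_imp_closed)

lemma emeasure_side: "emeasure lborel (side E p) = ennreal (measure lborel (side E p))"
  using emeasure_bounded_finite[OF bounded_side[OF bounded_E], of p]
  by (intro emeasure_eq_ennreal_measure) simp

text \<open>
  A flat point determines its normal, and with it the offset of its line.
\<close>

lemma disjoint_sides: "disjoint_family_on (\<lambda>p. on_line p ` side E p) N"
  unfolding disjoint_family_on_def
proof (intro ballI impI, rule ccontr)
  fix p q assume pq: "p \<in> N" "q \<in> N" "p \<noteq> q" "on_line p ` side E p \<inter> on_line q ` side E q \<noteq> {}"
  then obtain s t where st: "s \<in> side E p" "t \<in> side E q" "on_line p s = on_line q t"
    by auto
  then have "fst p = fst q"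
    by (auto simp: side_def intro: flat_at_normal_unique)
  moreover from this have "snd p = snd q"
    using on_line_inner(1)[of p s] on_line_inner(1)[of q t] unit_normal pq st(3) by simp
  ultimately show False using pq(3) by (simp add: prod_eq_iff)
qed

lemma frontier_subset: "frontier E \<subseteq> V \<union> (\<Union>p\<in>N. on_line p ` side E p)"
proof
  fix y assume y: "y \<in> frontier E"
  show "y \<in> V \<union> (\<Union>p\<in>N. on_line p ` side E p)"
  proof (cases "y \<in> V")
    case False
    then obtain p where p: "p \<in> N" "flat_at E (fst p) y" "y \<bullet> fst p = snd p"
      using frontier_flat y by blast
    then have "y = on_line p (y \<bullet> quarter_turn (fst p))"
      using on_line_inner_self unit_normal by blast
    moreover from this have "y \<bullet> quarter_turn (fst p) \<in> side E p"
      using p by (simp add: side_def)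
    ultimately show ?thesis using p by blast
  qed simp
qed

text \<open>
  Inner regularity of Lebesgue measure. Compact parts of different sides have a positive distance,
  which the sides themselves need not have.
\<close>

lemma obtain_compact_sides:
  assumes "0 < e"
  obtains K where "\<And>p. p \<in> N \<Longrightarrow> compact (K p)" "\<And>p. p \<in> N \<Longrightarrow> K p \<subseteq> side E p"
    "total_side_length - e \<le> (\<Sum>p\<in>N. measure lborel (K p))"
proof -
  \<comment> \<open>The error \<open>e\<close> is shared among the sides; adding \<open>1\<close> covers the case of no sides.\<close>
  define d where "d = e / (real (card N) + 1)"
  have d: "0 < d" "card N * d \<le> e"
    using assms by (auto simp: d_def field_simps)
  have "\<exists>K. compact K \<and> K \<subseteq> side E p \<and> measure lborel (side E p) - d \<le> measure lborel K" for p
  proof -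
    have "side E p \<in> sets lebesgue"
      using side_borel by (simp add: lmeasurable_iff_integrable)
    then obtain K where K: "closed K" "K \<subseteq> side E p" "emeasure lebesgue (side E p - K) < ennreal d"
      using sets_lebesgue_inner_closed d(1) by metis
    have cK: "compact K"
      using K bounded_side[OF bounded_E, of p] by (auto simp: compact_eq_bounded_closed intro: bounded_subset)
    have [measurable]: "K \<in> sets borel" using K by auto
    have fin: "emeasure lborel K \<noteq> \<infinity>"
      using emeasure_bounded_finite[of K] cK by (auto simp: compact_imp_bounded)
    have "measure lborel (side E p) - measure lborel K = measure lborel (side E p - K)"
      using K emeasure_side[of p] side_borel by (intro measure_Diff[symmetric]) auto
    also have "\<dots> \<le> d"
      using K(3) side_borel d(1) by (simp add: measure_def enn2real_leI)
    finally show ?thesis using K cK by (intro exI[of _ K]) auto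
  qed
  then obtain K where K: "\<And>p. compact (K p)" "\<And>p. K p \<subseteq> side E p"
    "\<And>p. measure lborel (side E p) - d \<le> measure lborel (K p)"
    by metis
  have "total_side_length - card N * d = (\<Sum>p\<in>N. measure lborel (side E p) - d)"
    by (simp add: total_side_length_def sum_subtractf)
  also have "\<dots> \<le> (\<Sum>p\<in>N. measure lborel (K p))"
    using K by (intro sum_mono)
  finally show thesis
    using K d by (intro that[of K]) auto
qed

text \<open>
  The sides and the finite set \<open>V\<close> cover the frontier, which bounds its Hausdorff measure from above;
  compact parts of the sides bound it from below.
\<close>

lemma hausdorff1_frontier: "hausdorff1 (frontier E) = ennreal total_side_length"
proof (rule antisym)
  have "hausdorff1 (frontier E) \<le> hausdorff1 (V \<union> (\<Union>p\<in>N. on_line p ` side E p))"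
    by (rule hausdorff1_mono[OF frontier_subset])
  also have "\<dots> \<le> hausdorff1 V + hausdorff1 (\<Union>p\<in>N. on_line p ` side E p)"
    by (rule hausdorff1_Un)
  also have "\<dots> \<le> 0 + (\<Sum>p\<in>N. hausdorff1 (on_line p ` side E p))"
    using hausdorff1_finite[OF finite_V] hausdorff1_UN[OF finite_N] by (intro add_mono) auto
  also have "\<dots> \<le> 0 + (\<Sum>p\<in>N. emeasure lborel (side E p))"
    using dist_on_line unit_normal open_side bounded_side[OF bounded_E]
    by (intro add_left_mono sum_mono hausdorff1_Lipschitz_image_open) auto
  also have "\<dots> = ennreal total_side_length"
    by (simp add: emeasure_side total_side_length_def sum_ennreal)
  finally show "hausdorff1 (frontier E) \<le> ennreal total_side_length" .
next
  show "ennreal total_side_length \<le> hausdorff1 (frontier E)"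
  proof (rule ennreal_le_epsilon)
    fix e :: real assume "0 < e"
    then obtain K where K: "\<And>p. p \<in> N \<Longrightarrow> compact (K p)" "\<And>p. p \<in> N \<Longrightarrow> K p \<subseteq> side E p"
        "total_side_length - e \<le> (\<Sum>p\<in>N. measure lborel (K p))"
      using obtain_compact_sides by blast
    have fin: "emeasure lborel (K p) = ennreal (measure lborel (K p))" if "p \<in> N" for p
      using emeasure_bounded_finite[of "K p"] K(1)[OF that]
      by (intro emeasure_eq_ennreal_measure) (auto simp: compact_imp_bounded)
    have "ennreal total_side_length \<le> ennreal ((\<Sum>p\<in>N. measure lborel (K p)) + e)"
      using K(3) by (intro ennreal_leI) simp
    also have "\<dots> = (\<Sum>p\<in>N. emeasure lborel (K p)) + ennreal e"
      using \<open>0 < e\<close> fin by (simp add: sum_nonneg sum_ennreal)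
    also have "(\<Sum>p\<in>N. emeasure lborel (K p)) \<le> hausdorff1 (frontier E)"
    proof (rule sum_lengths_le_hausdorff1[where \<phi> = on_line])
      show "disjoint_family_on (\<lambda>p. on_line p ` K p) N"
        using disjoint_sides K(2) unfolding disjoint_family_on_def by blast
      show "on_line p ` K p \<subseteq> frontier E" if "p \<in> N" for p
        using K(2)[OF that] flat_at_frontier by (auto simp: side_def)
    qed (use finite_N dist_on_line unit_normal K in auto)
    finally show "ennreal total_side_length \<le> hausdorff1 (frontier E) + ennreal e"
      by (simp add: add_right_mono)
  qed
qed

lemma perimeter_eq: "perimeter E = total_side_length"
  by (simp add: perimeter_def hausdorff1_frontier total_side_length_def sum_nonneg)

text \<open>
  Let \<open>y\<close> be a point of \<open>E\<close> nearest to \<open>x\<close>. It lies on the frontier, so it belongs to \<open>V\<close> or it is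
  flat, and in the latter case \<open>x\<close> lies on the outward normal at \<open>y\<close>, at distance less than \<open>r\<close>.
\<close>

lemma thicken_subset:
  assumes "0 < r"
  shows "thicken r E \<subseteq> E \<union> ((\<Union>v\<in>V. ball v r) \<union>
    (\<Union>p\<in>N. rectangle (quarter_turn (fst p)) (fst p) (side E p) {snd p..snd p + r}))"
proof
  fix x assume x: "x \<in> thicken r E"
  then have "E \<noteq> {}" by (auto simp: thicken_def)
  then obtain y where y: "y \<in> E" and near: "\<And>z. z \<in> E \<Longrightarrow> dist x y \<le> dist x z"
    using distance_attains_inf[OF closed_E] by metis
  have r: "dist x y < r"
    using x near by (fastforce simp: thicken_def dist_commute)
  show "x \<in> E \<union> ((\<Union>v\<in>V. ball v r) \<union>
    (\<Union>p\<in>N. rectangle (quarter_turn (fst p)) (fst p) (side E p) {snd p..snd p + r}))"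
  proof (cases "x \<in> E \<or> y \<in> V")
    case True
    then show ?thesis using r by (auto simp: dist_commute)
  next
    case False
    have "y \<notin> interior E"
    proof
      assume "y \<in> interior E"
      then obtain e where e: "0 < e" "cball y e \<subseteq> E"
        by (meson mem_interior_cball)
      have "x \<noteq> y" using y False by auto
      then have "0 < norm (x - y)" by simp
      have "y + t *\<^sub>R (x - y) \<in> E" if "0 < t" "t \<le> e / norm (x - y)" for t
      proof -
        have "t * norm (x - y) \<le> e"
          using that \<open>0 < norm (x - y)\<close> by (simp add: field_simps)
        then have "y + t *\<^sub>R (x - y) \<in> cball y e"
          using that by (simp add: dist_norm)
        then show ?thesis using e by blast
      qed
      then have "(x - y) \<bullet> (x - y) \<le> 0"
        using e \<open>0 < norm (x - y)\<close> by (intro nearest_point_direction[OF near, where \<epsilon> = "e / norm (x - y)"]) auto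
      then show False
        using \<open>x \<noteq> y\<close> by (metis inner_gt_zero_iff eq_iff_diff_eq_0 not_less)
    qed
    then have "y \<in> frontier E"
      using y closure_subset by (auto simp: frontier_def)
    then obtain p where p: "p \<in> N" "flat_at E (fst p) y" "y \<bullet> fst p = snd p"
      using frontier_flat False by blast
    note u = unit_normal[OF p(1)]
    have xy: "x = y + dist x y *\<^sub>R fst p"
      by (rule nearest_point_flat[OF near p(2)])
    have yl: "y = on_line p (y \<bullet> quarter_turn (fst p))"
      by (rule on_line_inner_self[OF u p(3)])
    have "fst p \<bullet> fst p = 1" using u by (simp add: norm_eq_1)
    have "x \<bullet> quarter_turn (fst p) = y \<bullet> quarter_turn (fst p)"
      by (subst xy) (simp add: inner_add_left inner_quarter_turn)
    moreover have "x \<bullet> fst p = snd p + dist x y"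
      by (subst xy) (simp add: inner_add_left p(3) \<open>fst p \<bullet> fst p = 1\<close>)
    moreover have "y \<bullet> quarter_turn (fst p) \<in> side E p"
      using p(2) yl by (simp add: side_def)
    ultimately have "x \<in> rectangle (quarter_turn (fst p)) (fst p) (side E p) {snd p..snd p + r}"
      using r by (simp add: rectangle_def)
    then show ?thesis using p(1) by blast
  qed
qed

lemma area_thicken_le:
  assumes "0 < r"
  shows "area (thicken r E) \<le> area E + r * total_side_length + card V * (r\<^sup>2 * pi)"
proof -
  let ?R = "\<lambda>p. rectangle (quarter_turn (fst p)) (fst p) (side E p) {snd p..snd p + r}"
  have R: "?R p \<in> lmeasurable" "measure lebesgue (?R p) = measure lborel (side E p) * r" if "p \<in> N" for p
    using assms unit_normal[OF that] side_borel[of p] bounded_side[OF bounded_E, of p]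
    by (auto intro!: lmeasurable_rectangle simp: measure_rectangle norm_quarter_turn inner_quarter_turn)
  have m: "E \<in> lmeasurable" "(\<Union>v\<in>V. ball v r) \<in> lmeasurable" "(\<Union>p\<in>N. ?R p) \<in> lmeasurable"
    using compact_E finite_V finite_N R by (auto intro: lmeasurable_compact fmeasurable.finite_UN)
  have "area (thicken r E) \<le> measure lebesgue (E \<union> ((\<Union>v\<in>V. ball v r) \<union> (\<Union>p\<in>N. ?R p)))"
    unfolding area_def using m thicken_subset[OF assms] lmeasurable_thicken[OF bounded_E]
    by (intro measure_mono_fmeasurable) auto
  also have "\<dots> \<le> area E + (measure lebesgue (\<Union>v\<in>V. ball v r) + measure lebesgue (\<Union>p\<in>N. ?R p))"
    unfolding area_def using m
    by (intro order_trans[OF measure_Un_le] add_left_mono measure_Un_le) auto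
  also have "measure lebesgue (\<Union>v\<in>V. ball v r) \<le> (\<Sum>v\<in>V. measure lebesgue (ball v r))"
    by (intro measure_UNION_le finite_V) auto
  also have "\<dots> = card V * (r\<^sup>2 * pi)"
    using assms by (simp add: circle_area)
  also have "measure lebesgue (\<Union>p\<in>N. ?R p) \<le> (\<Sum>p\<in>N. measure lebesgue (?R p))"
    using R by (intro measure_UNION_le finite_N) auto
  also have "\<dots> = r * total_side_length"
    using R by (simp add: total_side_length_def sum_distrib_left mult.commute)
  finally show ?thesis by simp
qed

text \<open>
  Each point of the side has a ball in which \<open>E\<close> is a half-plane. On a compact part of the side the
  radii have a common lower bound by the Lebesgue number lemma, so the outward normals of length \<open>d\<close>
  avoid \<open>E\<close>.
\<close>

lemma outside_near_compact_side:
  assumes p: "norm (fst p) = 1" and "compact K" "K \<subseteq> side E p"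
  obtains d where "0 < d" "\<And>t s. \<lbrakk>t \<in> K; 0 < s; s < d\<rbrakk> \<Longrightarrow> on_line p t + s *\<^sub>R fst p \<notin> E"
proof -
  \<comment> \<open>The balls centred on the line in which \<open>E\<close> is a half-plane.\<close>
  define \<G> where "\<G> = {ball y \<rho> | y \<rho>. y \<bullet> fst p = snd p \<and> (\<forall>z\<in>ball y \<rho>. z \<in> E \<longleftrightarrow> (z - y) \<bullet> fst p \<le> 0)}"
  have cpt: "compact (on_line p ` K)"
    using \<open>compact K\<close> dist_on_line[OF p]
    by (intro compact_continuous_image) (auto simp: continuous_on_iff)
  have sub: "on_line p ` K \<subseteq> \<Union>\<G>"
  proof
    fix y assume "y \<in> on_line p ` K"
    then have y: "flat_at E (fst p) y" "y \<bullet> fst p = snd p"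
      using assms(3) on_line_inner(1)[OF p] by (auto simp: side_def)
    then obtain \<rho> where "0 < \<rho>" "\<forall>z\<in>ball y \<rho>. z \<in> E \<longleftrightarrow> (z - y) \<bullet> fst p \<le> 0"
      by (auto simp: flat_at_def)
    then have "ball y \<rho> \<in> \<G>" "y \<in> ball y \<rho>"
      using y(2) unfolding \<G>_def by auto
    then show "y \<in> \<Union>\<G>" by blast
  qed
  have "open G" if "G \<in> \<G>" for G
    using that by (auto simp: \<G>_def)
  then obtain d where d: "0 < d" "\<And>x. x \<in> on_line p ` K \<Longrightarrow> \<exists>G\<in>\<G>. ball x d \<subseteq> G"
    using Heine_Borel_lemma[OF cpt sub] by metis
  show thesis
  proof
    fix t s assume t: "t \<in> K" and s: "0 < s" "s < d"
    have [simp]: "fst p \<bullet> fst p = 1" using p by (simp add: norm_eq_1)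
    obtain y \<rho> where y: "ball (on_line p t) d \<subseteq> ball y \<rho>" "y \<bullet> fst p = snd p"
        "\<forall>z\<in>ball y \<rho>. z \<in> E \<longleftrightarrow> (z - y) \<bullet> fst p \<le> 0"
      using d(2) t unfolding \<G>_def by blast
    have "on_line p t + s *\<^sub>R fst p \<in> ball (on_line p t) d"
      using s p by (simp add: dist_norm)
    moreover have "(on_line p t + s *\<^sub>R fst p - y) \<bullet> fst p = s"
      by (simp add: inner_diff_left inner_add_left on_line_inner[OF p] y(2))
    ultimately show "on_line p t + s *\<^sub>R fst p \<notin> E"
      using y s by auto
  qed (fact d(1))
qed

text \<open>
  Over compact parts of the sides that carry almost the total length, erect strips of width \<open>r\<close> on the
  outer side. For small \<open>r\<close> they avoid \<open>E\<close>, and they avoid each other because the compact parts have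
  positive distance; each has area \<open>r\<close> times the length of its base.
\<close>

lemma area_thicken_ge:
  assumes "0 < e"
  obtains r\<^sub>0 where "0 < r\<^sub>0"
    "\<And>r. \<lbrakk>0 < r; r < r\<^sub>0\<rbrakk> \<Longrightarrow> area E + r * (total_side_length - e) \<le> area (thicken r E)"
proof -
  obtain K where K: "\<And>p. p \<in> N \<Longrightarrow> compact (K p)" "\<And>p. p \<in> N \<Longrightarrow> K p \<subseteq> side E p"
      "total_side_length - e \<le> (\<Sum>p\<in>N. measure lborel (K p))"
    using obtain_compact_sides[OF assms] by blast
  have cpt: "compact (on_line p ` K p)" if "p \<in> N" for p
    using K(1)[OF that] dist_on_line[OF unit_normal[OF that]]
    by (intro compact_continuous_image) (auto simp: continuous_on_iff)
  have disj: "disjoint_family_on (\<lambda>p. on_line p ` K p) N"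
    using disjoint_sides K(2) unfolding disjoint_family_on_def by blast
  obtain \<delta> where \<delta>: "0 < \<delta>" "\<And>p q x y. \<lbrakk>p \<in> N; q \<in> N; p \<noteq> q; x \<in> on_line p ` K p; y \<in> on_line q ` K q\<rbrakk> \<Longrightarrow> \<delta> \<le> dist x y"
    by (rule separate_finitely_many_compacts[OF finite_N cpt disj]) blast+
  have "\<forall>p\<in>N. \<exists>d>0. \<forall>t\<in>K p. \<forall>s. 0 < s \<and> s < d \<longrightarrow> on_line p t + s *\<^sub>R fst p \<notin> E"
    using outside_near_compact_side[OF unit_normal K(1,2)] by metis
  then obtain d where d: "\<And>p. p \<in> N \<Longrightarrow> 0 < d p"
    "\<And>p t s. \<lbrakk>p \<in> N; t \<in> K p; 0 < s; s < d p\<rbrakk> \<Longrightarrow> on_line p t + s *\<^sub>R fst p \<notin> E"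
    by metis
  define r\<^sub>0 where "r\<^sub>0 = Min (insert (\<delta>/2) (d ` N))"
  have fin: "finite (insert (\<delta>/2) (d ` N))" using finite_N by simp
  have "0 < r\<^sub>0"
    unfolding r\<^sub>0_def using \<delta>(1) d(1) by (subst Min_gr_iff[OF fin]) auto
  moreover have "r\<^sub>0 \<le> \<delta>/2" "\<And>p. p \<in> N \<Longrightarrow> r\<^sub>0 \<le> d p"
    unfolding r\<^sub>0_def by (rule Min_le[OF fin], auto)+
  ultimately have r0: "0 < r\<^sub>0" "r\<^sub>0 \<le> \<delta>/2" "\<And>p. p \<in> N \<Longrightarrow> r\<^sub>0 \<le> d p"
    by auto
  show thesis
  proof (rule that[OF r0(1)])
    fix r assume r: "0 < r" "r < r\<^sub>0"
    let ?R = "\<lambda>p. rectangle (quarter_turn (fst p)) (fst p) (K p) {snd p<..<snd p + r}"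
    have R: "?R p \<in> lmeasurable" "measure lebesgue (?R p) = measure lborel (K p) * r" if "p \<in> N" for p
      using r unit_normal[OF that] borel_compact[OF K(1)[OF that]] compact_imp_bounded[OF K(1)[OF that]]
      by (auto intro!: lmeasurable_rectangle simp: measure_rectangle norm_quarter_turn inner_quarter_turn)
    have point: "\<exists>t\<in>K p. \<exists>s. 0 < s \<and> s < r \<and> x = on_line p t + s *\<^sub>R fst p" if "p \<in> N" "x \<in> ?R p" for p x
      using rectangle_point[OF unit_normal[OF that(1)], of x] that(2)
      by (intro bexI[of _ "x \<bullet> quarter_turn (fst p)"] exI[of _ "x \<bullet> fst p - snd p"]) (auto simp: rectangle_def)
    have RE: "?R p \<inter> E = {}" if "p \<in> N" for p
      using point[OF that] d(2)[OF that] r0(3)[OF that] r by fastforce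
    have Rt: "?R p \<subseteq> thicken r E" if pN: "p \<in> N" for p
    proof
      fix x assume "x \<in> ?R p"
      then obtain t s where ts: "t \<in> K p" "0 < s" "s < r" "x = on_line p t + s *\<^sub>R fst p"
        using point[OF pN] by blast
      then have "on_line p t \<in> E"
        using K(2)[OF pN] flat_at_mem by (auto simp: side_def)
      moreover have "x \<in> ball (on_line p t) r"
        using ts unit_normal[OF pN] by (simp add: dist_norm)
      ultimately show "x \<in> thicken r E" by (auto simp: thicken_def)
    qed
    have RR: "disjoint_family_on ?R N"
      unfolding disjoint_family_on_def
    proof (intro ballI impI, rule ccontr)
      fix p q assume pq: "p \<in> N" "q \<in> N" "p \<noteq> q" "?R p \<inter> ?R q \<noteq> {}"
      then obtain x where x: "x \<in> ?R p" "x \<in> ?R q" by blast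
      obtain t s where ts: "t \<in> K p" "0 < s" "s < r" "x = on_line p t + s *\<^sub>R fst p"
        using point[OF pq(1) x(1)] by blast
      obtain t' s' where ts': "t' \<in> K q" "0 < s'" "s' < r" "x = on_line q t' + s' *\<^sub>R fst q"
        using point[OF pq(2) x(2)] by blast
      have "dist (on_line p t) x < r" "dist x (on_line q t') < r"
        using ts unit_normal[OF pq(1)] by (simp add: dist_norm) (use ts' unit_normal[OF pq(2)] in \<open>simp add: dist_norm\<close>)
      then have "dist (on_line p t) (on_line q t') < 2 * r"
        using dist_triangle[of "on_line p t" "on_line q t'" x] by linarith
      then show False
        using \<delta>(2)[OF pq(1,2,3), of "on_line p t" "on_line q t'"] ts(1) ts'(1) r r0(2) by auto
    qed
    have "area E + r * (total_side_length - e) \<le> area E + (\<Sum>p\<in>N. measure lebesgue (?R p))"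
    proof -
      have "r * (total_side_length - e) \<le> r * (\<Sum>p\<in>N. measure lborel (K p))"
        using K(3) r by (intro mult_left_mono) auto
      then show ?thesis using R by (simp add: sum_distrib_left mult.commute)
    qed
    also have "(\<Sum>p\<in>N. measure lebesgue (?R p)) = measure lebesgue (\<Union>p\<in>N. ?R p)"
    proof (rule measure_finite_Union[OF finite_N _ RR, symmetric])
      show "?R ` N \<subseteq> sets lebesgue"
        using R(1) by blast
      show "emeasure lebesgue (?R p) \<noteq> \<infinity>" if "p \<in> N" for p
        using fmeasurableD2[OF R(1)[OF that]] by simp
    qed
    also have "area E + measure lebesgue (\<Union>p\<in>N. ?R p) = measure lebesgue (E \<union> (\<Union>p\<in>N. ?R p))"
    proof -
      have "E \<inter> (\<Union>p\<in>N. ?R p) = {}" using RE by blast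
      moreover have "E \<in> lmeasurable" "(\<Union>p\<in>N. ?R p) \<in> lmeasurable"
        using R(1) finite_N compact_E by (auto intro: lmeasurable_compact fmeasurable.finite_UN)
      ultimately show ?thesis
        unfolding area_def by (simp add: measure_Un3)
    qed
    also have "\<dots> \<le> area (thicken r E)"
      unfolding area_def
    proof (rule measure_mono_fmeasurable)
      show "E \<union> (\<Union>p\<in>N. ?R p) \<subseteq> thicken r E"
        using Rt subset_thicken[OF r(1)] by blast
      have "E \<in> lmeasurable" "(\<Union>p\<in>N. ?R p) \<in> lmeasurable"
        using R(1) finite_N compact_E by (auto intro: lmeasurable_compact fmeasurable.finite_UN)
      then show "E \<union> (\<Union>p\<in>N. ?R p) \<in> sets lebesgue" by blast
    qed (rule lmeasurable_thicken[OF bounded_E])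
    finally show "area E + r * (total_side_length - e) \<le> area (thicken r E)" .
  qed
qed

text \<open>
  The upper estimate has the error \<open>card V * pi * r\<^sup>2\<close> from the discs around the exceptional
  points, and the lower one has the error \<open>r * e\<close> with \<open>e\<close> arbitrarily small.
\<close>

theorem outer_minkowski_content:
  "((\<lambda>r. (area (thicken r E) - area E) / r) \<longlongrightarrow> perimeter E) (at_right 0)"
proof (rule tendstoI)
  fix e :: real assume e: "0 < e"
  \<comment> \<open>Adding \<open>1\<close> keeps the constant positive when there are no exceptional points.\<close>
  define c where "c = card V * pi + 1"
  have c: "0 < c" by (simp add: c_def add_nonneg_pos)
  obtain r\<^sub>0 where r0: "0 < r\<^sub>0"
    "\<And>r. \<lbrakk>0 < r; r < r\<^sub>0\<rbrakk> \<Longrightarrow> area E + r * (total_side_length - e/2) \<le> area (thicken r E)"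
    using area_thicken_ge[of "e/2"] e by auto
  have "0 < min r\<^sub>0 (e / c)" using r0(1) e c by simp
  then have "eventually (\<lambda>r. r \<in> {0<..<min r\<^sub>0 (e / c)}) (at_right 0)"
    by (rule eventually_at_right_real)
  then show "eventually (\<lambda>r. dist ((area (thicken r E) - area E) / r) (perimeter E) < e) (at_right 0)"
  proof eventually_elim
    case (elim r)
    then have r: "0 < r" "r < r\<^sub>0" "r < e / c" by auto
    have "r * total_side_length - r * (e/2) \<le> area (thicken r E) - area E"
      using r0(2)[OF r(1,2)] by (simp add: algebra_simps)
    then have "(total_side_length - e/2) \<le> (area (thicken r E) - area E) / r"
      using r(1) by (simp add: field_simps)
    moreover have "(area (thicken r E) - area E) / r \<le> total_side_length + r * (card V * pi)"
      using area_thicken_le[OF r(1)] r(1) by (simp add: field_simps power2_eq_square)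
    moreover have "r * (card V * pi) \<le> r * c"
      using r by (intro mult_left_mono) (auto simp: c_def)
    moreover have "r * c < e"
      using r c by (simp add: field_simps)
    ultimately show ?case
      using e by (simp add: perimeter_eq dist_real_def abs_less_iff)
  qed
qed

end

section \<open>The Brunn-Minkowski inequality in the plane\<close>

definition minkowski_sum :: "'a::plus set \<Rightarrow> 'a set \<Rightarrow> 'a set" where
  "minkowski_sum A B = (\<Union>x\<in>A. \<Union>y\<in>B. {x + y})"

lemma minkowski_sum_iff: "z \<in> minkowski_sum A B \<longleftrightarrow> (\<exists>x\<in>A. \<exists>y\<in>B. z = x + y)"
  by (auto simp: minkowski_sum_def)

lemma minkowski_sum_mono: "A \<subseteq> A' \<Longrightarrow> B \<subseteq> B' \<Longrightarrow> minkowski_sum A B \<subseteq> minkowski_sum A' B'"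
  by (auto simp: minkowski_sum_def)

lemma minkowski_sum_commute: "minkowski_sum A B = minkowski_sum B (A :: 'a::ab_semigroup_add set)"
  by (auto simp: set_eq_iff minkowski_sum_iff) (metis add.commute)+

lemma lmeasurable_minkowski_sum:
  fixes A B :: "'a::euclidean_space set"
  assumes "open A" "bounded A" "bounded B"
  shows "minkowski_sum A B \<in> lmeasurable"
  unfolding minkowski_sum_def using assms by (intro lmeasurable_open bounded_sums open_sums) auto

text \<open>
  The elementary sets of the Hadwiger-Ohmann proof: finite disjoint families of open boxes.
\<close>

definition box_family :: "(real^2) set set \<Rightarrow> bool" where
  "box_family \<A> \<longleftrightarrow> finite \<A> \<and> \<A> \<noteq> {} \<and> disjoint \<A> \<and> (\<forall>K\<in>\<A>. K \<noteq> {} \<and> (\<exists>a b. K = box a b))"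

lemma box_family_open_bounded:
  assumes "box_family \<A>" shows "open (\<Union>\<A>)" "bounded (\<Union>\<A>)" "\<Union>\<A> \<noteq> {}"
  using assms by (auto simp: box_family_def intro!: open_Union bounded_Union)

lemma area_open_pos:
  assumes "open U" "bounded U" "U \<noteq> {}" shows "0 < area U"
proof -
  have "\<not> negligible U" using open_not_negligible assms by blast
  then show ?thesis
    using lmeasurable_open[OF assms(2,1)] negligible_iff_measure0
    by (metis area_def measure_nonneg order_le_less)
qed

lemma area_box:
  assumes "box a b \<noteq> {}"
  shows "area (box a b) = (\<Prod>i\<in>Basis. b \<bullet> i - a \<bullet> i)"
proof -
  have "a \<bullet> i \<le> b \<bullet> i" if "i \<in> Basis" for i
    using assms that by (force simp: box_ne_empty)
  then show ?thesis
    unfolding area_def by (simp add: measure_def inner_diff_left prod_nonneg)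
qed

text \<open>
  The inequality of Brunn and Minkowski for two rectangles with parallel sides; after squaring it is the
  inequality between the arithmetic and the geometric mean of \<open>p * q'\<close> and \<open>p' * q\<close>.
\<close>

lemma sqrt_prod_superadditive:
  fixes p q p' q' :: real
  assumes "0 \<le> p" "0 \<le> q" "0 \<le> p'" "0 \<le> q'"
  shows "sqrt (p * q) + sqrt (p' * q') \<le> sqrt ((p + p') * (q + q'))"
proof (rule real_le_rsqrt)
  have "sqrt (p * q) * sqrt (p' * q') = sqrt ((p * q') * (p' * q))"
    by (simp add: real_sqrt_mult[symmetric] ac_simps)
  also have "\<dots> \<le> (p * q' + p' * q) / 2"
    using assms by (intro arith_geo_mean_sqrt) auto
  finally show "(sqrt (p * q) + sqrt (p' * q'))\<^sup>2 \<le> (p + p') * (q + q')"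
    using assms by (simp add: power2_sum algebra_simps)
qed

text \<open>
  Split \<open>z\<close> coordinate by coordinate in the proportion in which it divides the side of the large box.
\<close>

lemma box_subset_minkowski_sum:
  fixes a b c d :: "'a::euclidean_space"
  assumes ab: "box a b \<noteq> {}" and cd: "box c d \<noteq> {}"
  shows "box (a + c) (b + d) \<subseteq> minkowski_sum (box a b) (box c d)"
proof
  fix z assume z: "z \<in> box (a + c) (b + d)"
  \<comment> \<open>The relative position of \<open>z\<close> in the large box, used for both summands.\<close>
  define l where "l i = (z \<bullet> i - (a + c) \<bullet> i) / ((b + d) \<bullet> i - (a + c) \<bullet> i)" for i
  define x where "x = (\<Sum>i\<in>Basis. (a \<bullet> i + l i * (b \<bullet> i - a \<bullet> i)) *\<^sub>R i)"
  have *: "a \<bullet> i < x \<bullet> i \<and> x \<bullet> i < b \<bullet> i \<and> c \<bullet> i < (z - x) \<bullet> i \<and> (z - x) \<bullet> i < d \<bullet> i" if i: "i \<in> Basis" for i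
  proof -
    have w: "0 < b \<bullet> i - a \<bullet> i" "0 < d \<bullet> i - c \<bullet> i"
      using ab cd i by (auto simp: box_ne_empty)
    have pos: "0 < (b + d) \<bullet> i - (a + c) \<bullet> i"
      using w by (simp add: inner_add_left)
    have "(a + c) \<bullet> i < z \<bullet> i" "z \<bullet> i < (b + d) \<bullet> i"
      using z i by (auto simp: mem_box)
    then have l: "0 < l i" "l i < 1"
      using pos by (auto simp: l_def field_simps)
    have x: "x \<bullet> i = a \<bullet> i + l i * (b \<bullet> i - a \<bullet> i)"
      using i by (simp add: x_def)
    have "l i * ((b + d) \<bullet> i - (a + c) \<bullet> i) = z \<bullet> i - (a + c) \<bullet> i"
      using pos by (simp add: l_def)
    then have y: "(z - x) \<bullet> i = c \<bullet> i + l i * (d \<bullet> i - c \<bullet> i)"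
      by (simp add: x inner_diff_left inner_add_left algebra_simps)
    define m m' where "m = l i * (b \<bullet> i - a \<bullet> i)" and "m' = l i * (d \<bullet> i - c \<bullet> i)"
    have "0 < m" "m < b \<bullet> i - a \<bullet> i" "0 < m'" "m' < d \<bullet> i - c \<bullet> i"
      using w l by (auto simp: m_def m'_def)
    then show ?thesis unfolding x y m_def[symmetric] m'_def[symmetric] by linarith
  qed
  then have "x \<in> box a b" "z - x \<in> box c d" by (auto simp: mem_box)
  then show "z \<in> minkowski_sum (box a b) (box c d)"
    unfolding minkowski_sum_iff by (intro bexI[of _ x] bexI[of _ "z - x"]) auto
qed

lemma brunn_minkowski_box:
  fixes a b c d :: "real^2"
  assumes ab: "box a b \<noteq> {}" and cd: "box c d \<noteq> {}"
  shows "sqrt (area (box a b)) + sqrt (area (box c d)) \<le> sqrt (area (minkowski_sum (box a b) (box c d)))"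
proof -
  let ?e = "axis 1 1 :: real^2" and ?f = "axis 2 1 :: real^2"
  have ne: "?e \<noteq> ?f"
    by (simp add: axis_eq_axis)
  have Basis: "Basis = {?e, ?f}"
    by (auto simp: Basis_vec_def UNIV_2)
  have lt: "a \<bullet> i < b \<bullet> i" "c \<bullet> i < d \<bullet> i" if "i \<in> Basis" for i
    using ab cd that by (auto simp: box_ne_empty)
  have sum: "box (a + c) (b + d) \<noteq> {}"
    using lt by (auto simp: box_ne_empty inner_add_left add_strict_mono)
  have "sqrt (area (box a b)) + sqrt (area (box c d)) \<le> sqrt (area (box (a + c) (b + d)))"
    unfolding area_box[OF ab] area_box[OF cd] area_box[OF sum]
    using ne lt sqrt_prod_superadditive[of "b \<bullet> ?e - a \<bullet> ?e" "b \<bullet> ?f - a \<bullet> ?f" "d \<bullet> ?e - c \<bullet> ?e" "d \<bullet> ?f - c \<bullet> ?f"]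
    by (simp add: Basis inner_add_left less_imp_le add_diff_add)
  also have "\<dots> \<le> sqrt (area (minkowski_sum (box a b) (box c d)))"
    unfolding area_def real_sqrt_le_iff using box_subset_minkowski_sum[OF ab cd]
    by (intro measure_mono_fmeasurable lmeasurable_minkowski_sum) auto
  finally show ?thesis .
qed

lemma box_Int_halfspaces:
  fixes i :: "'a::euclidean_space"
  assumes i: "i \<in> Basis"
  shows "\<exists>c d. box a b \<inter> {x. x \<bullet> i < t} = box c d" "\<exists>c d. box a b \<inter> {x. t < x \<bullet> i} = box c d"
proof -
  have "box a b \<inter> {x. x \<bullet> i < t} = box a (b + (min (b \<bullet> i) t - b \<bullet> i) *\<^sub>R i)"
  proof (intro set_eqI)
    fix x
    have "(\<forall>j\<in>Basis. x \<bullet> j < b \<bullet> j) \<and> x \<bullet> i < t \<longleftrightarrow>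
        (\<forall>j\<in>Basis. x \<bullet> j < (b + (min (b \<bullet> i) t - b \<bullet> i) *\<^sub>R i) \<bullet> j)"
      using i by (auto simp: inner_add_left inner_Basis)
    then show "x \<in> box a b \<inter> {x. x \<bullet> i < t} \<longleftrightarrow> x \<in> box a (b + (min (b \<bullet> i) t - b \<bullet> i) *\<^sub>R i)"
      by (auto simp: mem_box)
  qed
  then show "\<exists>c d. box a b \<inter> {x. x \<bullet> i < t} = box c d" by blast
  have "box a b \<inter> {x. t < x \<bullet> i} = box (a + (max (a \<bullet> i) t - a \<bullet> i) *\<^sub>R i) b"
  proof (intro set_eqI)
    fix x
    have "(\<forall>j\<in>Basis. a \<bullet> j < x \<bullet> j) \<and> t < x \<bullet> i \<longleftrightarrow>
        (\<forall>j\<in>Basis. (a + (max (a \<bullet> i) t - a \<bullet> i) *\<^sub>R i) \<bullet> j < x \<bullet> j)"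
      using i by (auto simp: inner_add_left inner_Basis)
    then show "x \<in> box a b \<inter> {x. t < x \<bullet> i} \<longleftrightarrow> x \<in> box (a + (max (a \<bullet> i) t - a \<bullet> i) *\<^sub>R i) b"
      by (auto simp: mem_box)
  qed
  then show "\<exists>c d. box a b \<inter> {x. t < x \<bullet> i} = box c d" by blast
qed

text \<open>
  Cutting the boxes of a family by a half-plane \<open>H\<close> gives a family again, and it has fewer members
  if some box is lost.
\<close>

lemma box_family_restrict:
  assumes "box_family \<A>" and H: "\<And>a b. \<exists>c d. box a b \<inter> H = box c d" and ne: "\<Union>\<A> \<inter> H \<noteq> {}"
  obtains \<B> where "box_family \<B>" "\<Union>\<B> = \<Union>\<A> \<inter> H" "card \<B> \<le> card \<A>"
    "(\<exists>L\<in>\<A>. L \<inter> H = {}) \<Longrightarrow> card \<B> < card \<A>"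
proof
  let ?B = "(\<lambda>K. K \<inter> H) ` \<A> - {{}}"
  have fin: "finite \<A>" using assms(1) by (simp add: box_family_def)
  have boxes: "\<exists>a b. K = box a b" if "K \<in> ?B" for K
  proof -
    obtain L where "L \<in> \<A>" "K = L \<inter> H" using \<open>K \<in> ?B\<close> by blast
    moreover obtain a b where "L = box a b"
      using assms(1) \<open>L \<in> \<A>\<close> unfolding box_family_def by blast
    ultimately show ?thesis using H by simp
  qed
  have disj: "disjoint ?B"
    unfolding disjoint_def
  proof (intro ballI impI)
    fix X Y assume XY: "X \<in> ?B" "Y \<in> ?B" "X \<noteq> Y"
    then obtain K L where KL: "K \<in> \<A>" "L \<in> \<A>" "X = K \<inter> H" "Y = L \<inter> H" by auto
    then have "K \<noteq> L" using XY(3) by auto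
    then have "K \<inter> L = {}"
      using KL assms(1) by (auto simp: box_family_def disjoint_def)
    then show "X \<inter> Y = {}" using KL by auto
  qed
  show "box_family ?B"
    unfolding box_family_def
  proof (intro conjI ballI)
    show "?B \<noteq> {}" using ne by blast
  qed (use fin boxes disj in auto)
  show "\<Union>?B = \<Union>\<A> \<inter> H" by auto
  have "card ?B \<le> card ((\<lambda>K. K \<inter> H) ` \<A>)"
    using fin by (intro card_mono) auto
  also have "\<dots> \<le> card \<A>"
    by (rule card_image_le[OF fin])
  finally show "card ?B \<le> card \<A>" .
  show "card ?B < card \<A>" if L: "\<exists>L\<in>\<A>. L \<inter> H = {}"
  proof -
    obtain L where L: "L \<in> \<A>" "L \<inter> H = {}" using L by blast
    have "?B \<subseteq> (\<lambda>K. K \<inter> H) ` (\<A> - {L})"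
      using L by auto
    then have "card ?B \<le> card ((\<lambda>K. K \<inter> H) ` (\<A> - {L}))"
      using fin by (intro card_mono) auto
    also have "\<dots> \<le> card (\<A> - {L})"
      using fin by (intro card_image_le) auto
    also have "\<dots> < card \<A>"
      using L fin by (intro card_Diff1_less)
    finally show ?thesis .
  qed
qed

lemma area_split:
  assumes "B \<in> lmeasurable" "i \<noteq> 0"
  shows "area (B \<inter> {x. x \<bullet> i < s}) + area (B \<inter> {x. s < x \<bullet> i}) = area B"
proof -
  have op: "open {x. x \<bullet> i < s}" "open {x. s < x \<bullet> i}"
    by (intro open_Collect_less continuous_intros)+
  then have m: "B \<inter> {x. x \<bullet> i < s} \<in> lmeasurable" "B \<inter> {x. s < x \<bullet> i} \<in> lmeasurable"
    using assms(1) by (auto intro!: fmeasurable_Int_fmeasurable)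
  have "area (B \<inter> {x. x \<bullet> i < s}) + area (B \<inter> {x. s < x \<bullet> i})
      = measure lebesgue (B \<inter> {x. x \<bullet> i < s} \<union> B \<inter> {x. s < x \<bullet> i})"
  proof -
    have "(B \<inter> {x. x \<bullet> i < s}) \<inter> (B \<inter> {x. s < x \<bullet> i}) = {}" by auto
    then show ?thesis
      unfolding area_def using m by (simp add: measure_Un3)
  qed
  also have "\<dots> = area B"
    unfolding area_def
  proof (rule measure_negligible_symdiff[OF assms(1)])
    have "negligible {x. i \<bullet> x = s}"
      using assms(2) by (intro negligible_hyperplane) simp
    then show "negligible ((B - (B \<inter> {x. x \<bullet> i < s} \<union> B \<inter> {x. s < x \<bullet> i})) \<union>
        ((B \<inter> {x. x \<bullet> i < s} \<union> B \<inter> {x. s < x \<bullet> i}) - B))"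
      by (rule negligible_subset) (auto simp: inner_commute)
  qed
  finally show ?thesis .
qed

text \<open>
  The area to the left of a line is a Lipschitz continuous function of the position of the line, since
  the increment lies in a strip of bounded length. The intermediate value theorem applies.
\<close>

lemma halfplane_of_given_proportion:
  assumes B: "B \<in> lmeasurable" "bounded B" and i: "norm i = 1" and \<theta>: "0 \<le> \<theta>" "\<theta> \<le> 1"
  obtains s where "area (B \<inter> {x. x \<bullet> i < s}) = \<theta> * area B"
proof -
  define g where "g s = area (B \<inter> {x. x \<bullet> i < s})" for s
  obtain M where M: "0 < M" "\<And>x. x \<in> B \<Longrightarrow> norm x < M"
    using bounded_pos_less[of B] B by auto
  have Mi: "\<bar>x \<bullet> w\<bar> < M" if "x \<in> B" "norm w = 1" for x w
    using Cauchy_Schwarz_ineq2[of x w] M(2)[OF that(1)] that(2) by simp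
  have m: "B \<inter> {x. x \<bullet> i < s} \<in> lmeasurable" for s
    using B by (intro fmeasurable_Int_fmeasurable) (auto intro!: borel_open open_Collect_less continuous_intros)
  have lip: "\<bar>g s - g t\<bar> \<le> 2 * M * \<bar>s - t\<bar>" for s t
  proof -
    have *: "g s \<le> g t \<and> g t \<le> g s + 2 * M * (t - s)" if "s \<le> t" for s t
    proof
      show "g s \<le> g t"
        unfolding g_def area_def using m that by (intro measure_mono_fmeasurable) auto
      let ?R = "rectangle i (quarter_turn i) {s..t} {-M..M}"
      have R: "?R \<in> lmeasurable" "measure lebesgue ?R = (t - s) * (2 * M)"
        using i that M(1) by (auto intro!: lmeasurable_rectangle
          simp: measure_rectangle norm_quarter_turn inner_quarter_turn)
      have "B \<inter> {x. x \<bullet> i < t} \<subseteq> (B \<inter> {x. x \<bullet> i < s}) \<union> ?R"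
      proof
        fix x assume x: "x \<in> B \<inter> {x. x \<bullet> i < t}"
        then have "\<bar>x \<bullet> quarter_turn i\<bar> < M"
          using Mi[of x "quarter_turn i"] i by (simp add: norm_quarter_turn)
        then show "x \<in> (B \<inter> {x. x \<bullet> i < s}) \<union> ?R"
          using x by (auto simp: rectangle_def)
      qed
      then have "g t \<le> measure lebesgue ((B \<inter> {x. x \<bullet> i < s}) \<union> ?R)"
        unfolding g_def area_def using m R(1) by (intro measure_mono_fmeasurable) auto
      also have "\<dots> \<le> g s + measure lebesgue ?R"
        unfolding g_def area_def using m R by (intro measure_Un_le) auto
      finally show "g t \<le> g s + 2 * M * (t - s)" using R(2) by (simp add: mult.commute)
    qed
    show ?thesis
      using *[of s t] *[of t s] by (cases "s \<le> t") (auto simp: algebra_simps)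
  qed
  have cont: "continuous_on {-M..M} g"
    unfolding continuous_on_iff
  proof (intro ballI allI impI)
    fix x e :: real assume "0 < e"
    show "\<exists>d>0. \<forall>x'\<in>{-M..M}. dist x' x < d \<longrightarrow> dist (g x') (g x) < e"
    proof (intro exI[of _ "e / (2 * M)"] conjI ballI impI)
      show "0 < e / (2 * M)" using \<open>0 < e\<close> M(1) by simp
      fix y assume "dist y x < e / (2 * M)"
      then have "2 * M * \<bar>y - x\<bar> < e"
        using M(1) by (simp add: dist_real_def field_simps)
      then show "dist (g y) (g x) < e"
        using lip[of y x] by (simp add: dist_real_def)
    qed
  qed
  have "B \<inter> {x. x \<bullet> i < -M} = {}" "B \<inter> {x. x \<bullet> i < M} = B"
    using Mi[OF _ i] by (auto simp: abs_less_iff) (smt (verit))+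
  then have ends: "g (-M) = 0" "g M = area B"
    by (simp_all add: g_def area_def)
  have "0 \<le> area B" by (simp add: area_def)
  then have "g (-M) \<le> \<theta> * area B" "\<theta> * area B \<le> g M"
    unfolding ends using \<theta> by (auto intro: mult_left_le_one_le)
  then obtain s where "g s = \<theta> * area B"
    using IVT'[OF _ _ _ cont] M(1) by fastforce
  then show thesis by (intro that) (simp add: g_def)
qed

text \<open>
  The Hadwiger-Ohmann argument, by induction on the total number of boxes. Two disjoint boxes of
  one family are separated by an axis-parallel line; cut this family along it, and cut the other family
  along a parallel line in the same proportion \<open>\<theta>\<close>. On each side there are fewer boxes, and the two
  sums of corresponding parts lie on different sides of a line. So the induction hypotheses add up, and
  because of the equal proportions they add up to \<open>(\<theta> + (1 - \<theta>)) * (sqrt a + sqrt b)\<^sup>2\<close>,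
  where \<open>a\<close> and \<open>b\<close> are the areas of the two families.
\<close>

lemma brunn_minkowski_box_family:
  assumes "box_family \<A>" "box_family \<B>"
  shows "sqrt (area (\<Union>\<A>)) + sqrt (area (\<Union>\<B>)) \<le> sqrt (area (minkowski_sum (\<Union>\<A>) (\<Union>\<B>)))"
  using assms
proof (induction "card \<A> + card \<B>" arbitrary: \<A> \<B> rule: less_induct)
  case (less \<A> \<B>)
  have split: "sqrt (area (\<Union>X)) + sqrt (area (\<Union>Y)) \<le> sqrt (area (minkowski_sum (\<Union>X) (\<Union>Y)))"
    if XY: "box_family X" "box_family Y" "1 < card X" "card X + card Y = card \<A> + card \<B>" for X Y
  proof -
    obtain i t P Q where i: "i \<in> Basis" and P: "P \<in> X" "P \<noteq> {}" "P \<subseteq> {x. x \<bullet> i < t}"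
      and Q: "Q \<in> X" "Q \<noteq> {}" "Q \<subseteq> {x. t < x \<bullet> i}"
    proof -
      obtain K where K: "K \<in> X" using XY(1) by (auto simp: box_family_def)
      then have "X \<noteq> {K}" using XY(3) by auto
      then obtain L where L: "L \<in> X" "K \<noteq> L" using K by blast
      obtain a b where ab: "K = box a b" "K \<noteq> {}"
        using K XY(1) unfolding box_family_def by blast
      obtain c d where cd: "L = box c d" "L \<noteq> {}"
        using L XY(1) unfolding box_family_def by blast
      have "box a b \<inter> box c d = {}"
        using K L XY(1) ab cd by (auto simp: box_family_def disjoint_def)
      then obtain i where i: "i \<in> Basis" "b \<bullet> i \<le> c \<bullet> i \<or> d \<bullet> i \<le> a \<bullet> i"
        using ab cd by (force simp: disjoint_interval box_ne_empty)
      show thesis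
      proof (cases "b \<bullet> i \<le> c \<bullet> i")
        case True
        then have "K \<subseteq> {x. x \<bullet> i < b \<bullet> i}" "L \<subseteq> {x. b \<bullet> i < x \<bullet> i}"
          using i(1) by (fastforce simp: ab cd mem_box)+
        then show thesis using that i K L ab cd by metis
      next
        case False
        then have "L \<subseteq> {x. x \<bullet> i < d \<bullet> i}" "K \<subseteq> {x. d \<bullet> i < x \<bullet> i}"
          using i by (fastforce simp: ab cd mem_box)+
        then show thesis using that i K L ab cd by metis
      qed
    qed
    let ?A = "\<Union>X" and ?B = "\<Union>Y"
    have A: "open ?A" "bounded ?A" "?A \<noteq> {}" and B: "open ?B" "bounded ?B" "?B \<noteq> {}"
      using box_family_open_bounded XY(1,2) by blast+
    have lm: "?A \<in> lmeasurable" "?B \<in> lmeasurable"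
      using A B by (auto intro: lmeasurable_open)
    have norm_i: "norm i = 1" "i \<noteq> 0" using i by auto
    have op: "open {x. x \<bullet> i < r}" "open {x. r < x \<bullet> i}" for r
      by (intro open_Collect_less continuous_intros)+
    define A1 A2 where "A1 = ?A \<inter> {x. x \<bullet> i < t}" and "A2 = ?A \<inter> {x. t < x \<bullet> i}"
    have A12: "open A1" "bounded A1" "A1 \<noteq> {}" "open A2" "bounded A2" "A2 \<noteq> {}"
      using A op P Q unfolding A1_def A2_def by (auto intro: bounded_subset)
    define \<theta> where "\<theta> = area A1 / area ?A"
    have pos: "0 < area ?A" "0 < area ?B" "0 < area A1" "0 < area A2"
      using A B A12 by (auto intro: area_open_pos)
    have sumA: "area A1 + area A2 = area ?A"
      unfolding A1_def A2_def by (rule area_split[OF lm(1) norm_i(2)])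
    have \<theta>: "0 < \<theta>" "\<theta> < 1" "area A1 = \<theta> * area ?A"
      using pos sumA by (auto simp: \<theta>_def)
    have \<theta>': "area A2 = (1 - \<theta>) * area ?A"
      using sumA \<theta>(3) by (simp add: algebra_simps)
    obtain s where s: "area (?B \<inter> {x. x \<bullet> i < s}) = \<theta> * area ?B"
      using halfplane_of_given_proportion[OF lm(2) B(2) norm_i(1)] \<theta>(1,2) by (metis less_imp_le)
    define B1 B2 where "B1 = ?B \<inter> {x. x \<bullet> i < s}" and "B2 = ?B \<inter> {x. s < x \<bullet> i}"
    have B12: "area B1 = \<theta> * area ?B" "area B2 = (1 - \<theta>) * area ?B"
      using s area_split[OF lm(2) norm_i(2), of s] by (auto simp: B1_def B2_def algebra_simps)
    then have "0 < area B1" "0 < area B2"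
      using \<theta>(1,2) pos(2) by auto
    then have neB: "B1 \<noteq> {}" "B2 \<noteq> {}"
      by (auto simp: area_def)
    have opB: "open B1" "bounded B1" "open B2" "bounded B2"
      using B op unfolding B1_def B2_def by (auto intro: bounded_subset)
    obtain X1 where X1: "box_family X1" "\<Union>X1 = A1" "(\<exists>L\<in>X. L \<inter> {x. x \<bullet> i < t} = {}) \<Longrightarrow> card X1 < card X"
      using box_family_restrict[OF XY(1) box_Int_halfspaces(1)[OF i]] A12(3) unfolding A1_def by metis
    obtain X2 where X2: "box_family X2" "\<Union>X2 = A2" "(\<exists>L\<in>X. L \<inter> {x. t < x \<bullet> i} = {}) \<Longrightarrow> card X2 < card X"
      using box_family_restrict[OF XY(1) box_Int_halfspaces(2)[OF i]] A12(6) unfolding A2_def by metis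
    obtain Y1 where Y1: "box_family Y1" "\<Union>Y1 = B1" "card Y1 \<le> card Y"
      using box_family_restrict[OF XY(2) box_Int_halfspaces(1)[OF i]] neB(1) unfolding B1_def by metis
    obtain Y2 where Y2: "box_family Y2" "\<Union>Y2 = B2" "card Y2 \<le> card Y"
      using box_family_restrict[OF XY(2) box_Int_halfspaces(2)[OF i]] neB(2) unfolding B2_def by metis
    have "Q \<inter> {x. x \<bullet> i < t} = {}" "P \<inter> {x. t < x \<bullet> i} = {}"
      using P(3) Q(3) by fastforce+
    then have "card X1 < card X" "card X2 < card X"
      using X1(3) X2(3) P(1) Q(1) by blast+
    then have IH: "sqrt (area A1) + sqrt (area B1) \<le> sqrt (area (minkowski_sum A1 B1))"
      "sqrt (area A2) + sqrt (area B2) \<le> sqrt (area (minkowski_sum A2 B2))"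
      using less.hyps[of X1 Y1] less.hyps[of X2 Y2] X1 X2 Y1 Y2 XY(4) by auto
    have part: "\<tau> * (sqrt (area ?A) + sqrt (area ?B))\<^sup>2 \<le> area M"
      if "0 < \<tau>" "sqrt (\<tau> * area ?A) + sqrt (\<tau> * area ?B) \<le> sqrt (area M)" for \<tau> M
    proof -
      have "\<tau> * (sqrt (area ?A) + sqrt (area ?B))\<^sup>2 = (sqrt (\<tau> * area ?A) + sqrt (\<tau> * area ?B))\<^sup>2"
        using that(1) by (simp add: real_sqrt_mult power_mult_distrib distrib_left[symmetric])
      also have "\<dots> \<le> (sqrt (area M))\<^sup>2"
        using that pos by (intro power_mono) auto
      finally show ?thesis by (simp add: area_def)
    qed
    have M: "minkowski_sum A1 B1 \<in> lmeasurable" "minkowski_sum A2 B2 \<in> lmeasurable"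
      "minkowski_sum ?A ?B \<in> lmeasurable"
      using A12 opB A B by (auto intro: lmeasurable_minkowski_sum)
    have "minkowski_sum A1 B1 \<inter> minkowski_sum A2 B2 = {}"
      by (auto simp: minkowski_sum_iff A1_def A2_def B1_def B2_def)
        (metis add_strict_mono inner_add_left less_asym)
    then have disj: "measure lebesgue (minkowski_sum A1 B1 \<union> minkowski_sum A2 B2)
        = area (minkowski_sum A1 B1) + area (minkowski_sum A2 B2)"
      using M by (simp add: measure_Un3 area_def)
    have sub: "minkowski_sum A1 B1 \<union> minkowski_sum A2 B2 \<subseteq> minkowski_sum ?A ?B"
      by (intro Un_least minkowski_sum_mono) (auto simp: A1_def A2_def B1_def B2_def)
    have "(sqrt (area ?A) + sqrt (area ?B))\<^sup>2
        = \<theta> * (sqrt (area ?A) + sqrt (area ?B))\<^sup>2 + (1 - \<theta>) * (sqrt (area ?A) + sqrt (area ?B))\<^sup>2"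
      by (simp add: algebra_simps)
    also have "\<dots> \<le> area (minkowski_sum A1 B1) + area (minkowski_sum A2 B2)"
      using IH \<theta> \<theta>' B12 by (intro add_mono part) auto
    also have "\<dots> \<le> area (minkowski_sum ?A ?B)"
      unfolding disj[symmetric] area_def[of "minkowski_sum ?A ?B"] using M sub
      by (intro measure_mono_fmeasurable) auto
    finally show ?thesis by (rule real_le_rsqrt)
  qed
  have fin: "0 < card \<A>" "0 < card \<B>"
    using less.prems by (auto simp: box_family_def card_gt_0_iff)
  then consider "1 < card \<A>" | "1 < card \<B>" | "card \<A> = 1" "card \<B> = 1"
    by linarith
  then show ?case
  proof cases
    case 1
    then show ?thesis using split less.prems by blast
  next
    case 2
    then show ?thesis
      using split[of \<B> \<A>] less.prems by (simp add: minkowski_sum_commute add.commute)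
  next
    case 3
    then obtain K L where KL: "\<A> = {K}" "\<B> = {L}"
      by (auto simp: card_1_singleton_iff)
    have "\<exists>a b. K = box a b" "\<exists>c d. L = box c d" "K \<noteq> {}" "L \<noteq> {}"
      using less.prems KL unfolding box_family_def by blast+
    then obtain a b c d where "K = box a b" "L = box c d" "K \<noteq> {}" "L \<noteq> {}"
      by blast
    then show ?thesis using KL brunn_minkowski_box by simp
  qed
qed

text \<open>
  The open set is a countable union of closed boxes with disjoint interiors. Passing to interiors loses
  a null set, and finitely many of them exhaust the area up to \<open>e\<close>.
\<close>

lemma inner_box_family:
  assumes U: "open U" "bounded U" "U \<noteq> {}" and "0 < e"
  obtains \<A> where "box_family \<A>" "\<Union>\<A> \<subseteq> U" "area U - e \<le> area (\<Union>\<A>)"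
proof -
  obtain a where "U \<subseteq> box (-a) a"
    using bounded_subset_box_symmetric[OF U(2)] by metis
  then have Ua: "U \<subseteq> cbox (-a) a" "box (-a) a \<noteq> {}"
    using U(3) box_subset_cbox by blast+
  \<comment> \<open>With this gauge the covering lemma yields boxes contained in \<open>U\<close>, so they cover exactly \<open>U\<close>.\<close>
  define g where "g x = (if x \<in> U then U else ball x 1)" for x
  have g: "gauge g"
    using U(1) by (auto simp: gauge_def g_def)
  obtain \<D> where \<D>: "countable \<D>"
    "\<And>K. K \<in> \<D> \<Longrightarrow> interior K \<noteq> {} \<and> (\<exists>c d. K = cbox c d)"
    "pairwise (\<lambda>A B. interior A \<inter> interior B = {}) \<D>"
    "\<And>K. K \<in> \<D> \<Longrightarrow> \<exists>x \<in> U \<inter> K. K \<subseteq> g x" "U \<subseteq> \<Union>\<D>"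
    by (rule covering_lemma[OF Ua g]) auto
  have sub: "K \<subseteq> U" if "K \<in> \<D>" for K
    using \<D>(4)[OF that] by (auto simp: g_def)
  have "\<D> \<noteq> {}" using \<D>(5) U(3) by auto
  define F where "F n = (\<Union>k\<le>n. interior (from_nat_into \<D> k))" for n
  have mem: "from_nat_into \<D> k \<in> \<D>" for k
    by (rule from_nat_into[OF \<open>\<D> \<noteq> {}\<close>])
  have Flim: "(\<Union>n. F n) = (\<Union>K\<in>\<D>. interior K)"
  proof
    show "(\<Union>n. F n) \<subseteq> (\<Union>K\<in>\<D>. interior K)"
      using mem by (auto simp: F_def)
    show "(\<Union>K\<in>\<D>. interior K) \<subseteq> (\<Union>n. F n)"
    proof
      fix x assume "x \<in> (\<Union>K\<in>\<D>. interior K)"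
      then obtain K where "K \<in> \<D>" "x \<in> interior K" by blast
      moreover obtain k where "from_nat_into \<D> k = K"
        using from_nat_into_surj[OF \<D>(1) \<open>K \<in> \<D>\<close>] by blast
      ultimately have "x \<in> F k" by (auto simp: F_def)
      then show "x \<in> (\<Union>n. F n)" by blast
    qed
  qed
  have Fop: "open (F n)" for n by (auto simp: F_def)
  have FU: "(\<Union>n. F n) \<subseteq> U"
    unfolding Flim using sub interior_subset by blast
  have lmF: "(\<Union>n. F n) \<in> lmeasurable"
    using FU Fop U by (intro lmeasurable_open) (auto intro: bounded_subset)
  have "(\<lambda>n. measure lebesgue (F n)) \<longlonglongrightarrow> measure lebesgue (\<Union>n. F n)"
  proof (rule Lim_measure_incseq)
    show "range F \<subseteq> sets lebesgue" using Fop by (auto intro: borel_open)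
    show "incseq F" by (auto simp: incseq_def F_def intro: order_trans)
    show "emeasure lebesgue (\<Union>n. F n) \<noteq> \<infinity>" using fmeasurableD2[OF lmF] by simp
  qed
  moreover have "measure lebesgue (\<Union>n. F n) = area U"
    unfolding area_def
  proof (rule measure_negligible_symdiff)
    show "U \<in> lmeasurable" using U by (intro lmeasurable_open)
    have "negligible (K - interior K)" if "K \<in> \<D>" for K
    proof -
      obtain c d where "K = cbox c d" using \<D>(2) \<open>K \<in> \<D>\<close> by blast
      then show ?thesis using negligible_frontier_interval[of c d] by simp
    qed
    then have "negligible (\<Union>K\<in>\<D>. K - interior K)"
      using \<D>(1) by (intro negligible_countable_Union) auto
    moreover have "(U - (\<Union>n. F n)) \<union> ((\<Union>n. F n) - U) \<subseteq> (\<Union>K\<in>\<D>. K - interior K)"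
    proof
      fix x assume "x \<in> (U - (\<Union>n. F n)) \<union> ((\<Union>n. F n) - U)"
      then have x: "x \<in> U" "x \<notin> (\<Union>K\<in>\<D>. interior K)"
        using FU unfolding Flim by auto
      then obtain K where "K \<in> \<D>" "x \<in> K"
        using \<D>(5) by auto
      then show "x \<in> (\<Union>K\<in>\<D>. K - interior K)"
        using x(2) by auto
    qed
    ultimately show "negligible ((U - (\<Union>n. F n)) \<union> ((\<Union>n. F n) - U))"
      by (rule negligible_subset)
  qed
  ultimately have "eventually (\<lambda>n. area U - e < measure lebesgue (F n)) sequentially"
    using \<open>0 < e\<close> by (intro order_tendstoD(1)) auto
  then obtain n where n: "area U - e < area (F n)"
    by (auto simp: eventually_sequentially area_def)
  let ?A = "interior ` from_nat_into \<D> ` {..n}"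
  have UA: "\<Union>?A = F n" by (auto simp: F_def)
  have "box_family ?A"
    unfolding box_family_def
  proof (intro conjI ballI)
    show "disjoint ?A"
      unfolding disjoint_def
    proof (intro ballI impI)
      fix X Y assume XY: "X \<in> ?A" "Y \<in> ?A" "X \<noteq> Y"
      then obtain k l where "X = interior (from_nat_into \<D> k)" "Y = interior (from_nat_into \<D> l)"
        by blast
      moreover from this have "from_nat_into \<D> k \<noteq> from_nat_into \<D> l" using XY(3) by auto
      ultimately show "X \<inter> Y = {}"
        using \<D>(3) mem[of k] mem[of l] by (simp add: pairwise_def)
    qed
    fix K assume "K \<in> ?A"
    then obtain k where k: "K = interior (from_nat_into \<D> k)" by blast
    obtain c d where "from_nat_into \<D> k = cbox c d"
      using \<D>(2)[OF mem[of k]] by blast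
    then have "K = box c d" by (simp add: k)
    then show "\<exists>a b. K = box a b" by blast
    show "K \<noteq> {}"
      using \<D>(2)[OF mem[of k]] by (simp add: k)
  qed auto
  moreover have "\<Union>?A \<subseteq> U" "area U - e \<le> area (\<Union>?A)"
    unfolding UA using FU n by auto
  ultimately show thesis by (rule that)
qed

theorem brunn_minkowski_open:
  assumes U: "open U" "bounded U" "U \<noteq> {}" and W: "open W" "bounded W" "W \<noteq> {}"
  shows "sqrt (area U) + sqrt (area W) \<le> sqrt (area (minkowski_sum U W))"
proof -
  have le: "sqrt (area U - e) + sqrt (area W - e) \<le> sqrt (area (minkowski_sum U W))" if e: "0 < e" for e
  proof -
    obtain \<A> where A: "box_family \<A>" "\<Union>\<A> \<subseteq> U" "area U - e \<le> area (\<Union>\<A>)"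
      by (rule inner_box_family[OF U e])
    obtain \<B> where B: "box_family \<B>" "\<Union>\<B> \<subseteq> W" "area W - e \<le> area (\<Union>\<B>)"
      by (rule inner_box_family[OF W e])
    have "sqrt (area U - e) + sqrt (area W - e) \<le> sqrt (area (\<Union>\<A>)) + sqrt (area (\<Union>\<B>))"
      using A(3) B(3) by (intro add_mono) auto
    also have "\<dots> \<le> sqrt (area (minkowski_sum (\<Union>\<A>) (\<Union>\<B>)))"
      by (rule brunn_minkowski_box_family[OF A(1) B(1)])
    also have "\<dots> \<le> sqrt (area (minkowski_sum U W))"
      unfolding area_def real_sqrt_le_iff
      using A B U W box_family_open_bounded[OF A(1)] box_family_open_bounded[OF B(1)]
      by (intro measure_mono_fmeasurable minkowski_sum_mono lmeasurable_minkowski_sum fmeasurableD) auto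
    finally show ?thesis .
  qed
  have "((\<lambda>e. sqrt (area U - e) + sqrt (area W - e)) \<longlongrightarrow> sqrt (area U - 0) + sqrt (area W - 0)) (at_right 0)"
    by (intro tendsto_intros)
  moreover have "eventually (\<lambda>e. sqrt (area U - e) + sqrt (area W - e) \<le> sqrt (area (minkowski_sum U W))) (at_right 0)"
    using le by (auto simp: eventually_at_filter)
  ultimately show ?thesis
    using tendsto_upperbound[of _ _ "at_right (0::real)"] by fastforce
qed

text \<open>
  The Brunn-Minkowski inequality for a compact set and a disc, which contains the isoperimetric
  inequality. A compact set need not contain boxes, so part \<open>e\<close> of the radius is spent on replacing
  \<open>C\<close> by the open set \<open>thicken e C\<close>, and the disc of radius \<open>r - e\<close> is added to that.
\<close>

theorem sqrt_area_thicken_ge: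
  assumes C: "compact C" "C \<noteq> {}" and r: "0 < r"
  shows "sqrt (area C) + sqrt pi * r \<le> sqrt (area (thicken r C))"
proof -
  have bC: "bounded C" using C(1) by (rule compact_imp_bounded)
  have le: "sqrt (area C) + sqrt pi * (r - e) \<le> sqrt (area (thicken r C))" if e: "0 < e" "e < r" for e
  proof -
    have "sqrt (area C) \<le> sqrt (area (thicken e C))"
      unfolding area_def real_sqrt_le_iff using subset_thicken[OF e(1)] lmeasurable_thicken[OF bC]
        fmeasurableD[OF lmeasurable_compact[OF C(1)]] by (intro measure_mono_fmeasurable)
    moreover have "area (ball (0::real^2) (r - e)) = (r - e)\<^sup>2 * pi"
      using e by (simp add: area_def circle_area)
    then have "sqrt (area (ball (0::real^2) (r - e))) = sqrt pi * (r - e)"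
      using e by (simp add: real_sqrt_mult)
    ultimately have "sqrt (area C) + sqrt pi * (r - e) \<le> sqrt (area (thicken e C)) + sqrt (area (ball (0::real^2) (r - e)))"
      by simp
    also have "\<dots> \<le> sqrt (area (minkowski_sum (thicken e C) (ball 0 (r - e))))"
      using e C(2) subset_thicken[OF e(1), of C]
      by (intro brunn_minkowski_open open_thicken bounded_thicken[OF bC]) auto
    also have "\<dots> \<le> sqrt (area (thicken r C))"
      unfolding area_def real_sqrt_le_iff
    proof (rule measure_mono_fmeasurable)
      show "minkowski_sum (thicken e C) (ball 0 (r - e)) \<subseteq> thicken r C"
      proof
        fix z assume "z \<in> minkowski_sum (thicken e C) (ball 0 (r - e))"
        then obtain c x y where *: "c \<in> C" "dist c x < e" "norm y < r - e" "z = x + y"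
          by (auto simp: minkowski_sum_iff thicken_def)
        have "dist c z \<le> dist c x + dist x z" by (rule dist_triangle)
        also have "\<dots> < r" using * by (simp add: dist_norm)
        finally show "z \<in> thicken r C" using *(1) by (auto simp: thicken_def)
      qed
      show "minkowski_sum (thicken e C) (ball 0 (r - e)) \<in> sets lebesgue"
        by (intro fmeasurableD lmeasurable_minkowski_sum open_thicken bounded_thicken[OF bC] bounded_ball)
    qed (rule lmeasurable_thicken[OF bC])
    finally show ?thesis .
  qed
  have "((\<lambda>e. sqrt (area C) + sqrt pi * (r - e)) \<longlongrightarrow> sqrt (area C) + sqrt pi * (r - 0)) (at_right 0)"
    by (intro tendsto_intros)
  moreover have "eventually (\<lambda>e. sqrt (area C) + sqrt pi * (r - e) \<le> sqrt (area (thicken r C))) (at_right 0)"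
    using eventually_at_right_real[OF r] by eventually_elim (use le in auto)
  ultimately show ?thesis
    using tendsto_upperbound[of _ _ "at_right (0::real)"] by fastforce
qed

section \<open>Unions of polygonal figures\<close>

lemma flat_atI:
  assumes "norm \<nu> = 1" "open W" "y \<in> W" "\<And>z. z \<in> W \<Longrightarrow> z \<in> E \<longleftrightarrow> z \<bullet> \<nu> \<le> y \<bullet> \<nu>"
  shows "flat_at E \<nu> y"
proof -
  obtain \<rho> where "0 < \<rho>" "ball y \<rho> \<subseteq> W"
    using assms(2,3) open_contains_ball by blast
  then show ?thesis
    using assms(1,4) unfolding flat_at_def by (auto intro!: exI[of _ \<rho>] simp: inner_diff_left)
qed

lemma flat_atE:
  assumes "flat_at E \<nu> y"
  obtains W where "open W" "y \<in> W" "\<And>z. z \<in> W \<Longrightarrow> z \<in> E \<longleftrightarrow> z \<bullet> \<nu> \<le> y \<bullet> \<nu>"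
proof -
  obtain \<rho> where \<rho>: "0 < \<rho>" "\<forall>z\<in>ball y \<rho>. z \<in> E \<longleftrightarrow> (z - y) \<bullet> \<nu> \<le> 0"
    using assms by (auto simp: flat_at_def)
  then show thesis
    by (intro that[of "ball y \<rho>"]) (auto simp: inner_diff_left)
qed

lemma flat_at_Un_closed:
  assumes "flat_at A \<nu> y" "closed B" "y \<notin> B"
  shows "flat_at (A \<union> B) \<nu> y"
proof -
  obtain W where W: "open W" "y \<in> W" "\<And>z. z \<in> W \<Longrightarrow> z \<in> A \<longleftrightarrow> z \<bullet> \<nu> \<le> y \<bullet> \<nu>"
    by (rule flat_atE[OF assms(1)]) blast
  show ?thesis
    by (rule flat_atI[of _ "W - B"]) (use assms W in \<open>auto simp: flat_at_def\<close>)
qed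

lemma flat_at_Un_same:
  assumes "flat_at A \<nu> y" "flat_at B \<nu> y"
  shows "flat_at (A \<union> B) \<nu> y"
proof -
  obtain W where W: "open W" "y \<in> W" "\<And>z. z \<in> W \<Longrightarrow> z \<in> A \<longleftrightarrow> z \<bullet> \<nu> \<le> y \<bullet> \<nu>"
    by (rule flat_atE[OF assms(1)]) blast
  obtain X where X: "open X" "y \<in> X" "\<And>z. z \<in> X \<Longrightarrow> z \<in> B \<longleftrightarrow> z \<bullet> \<nu> \<le> y \<bullet> \<nu>"
    by (rule flat_atE[OF assms(2)]) blast
  show ?thesis
    by (rule flat_atI[of _ "W \<inter> X"]) (use assms W X in \<open>auto simp: flat_at_def\<close>)
qed

lemma flat_at_Un_opposite:
  assumes "flat_at A \<nu> y" "flat_at B (- \<nu>) y"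
  shows "y \<in> interior (A \<union> B)"
proof -
  obtain W where W: "open W" "y \<in> W" "\<And>z. z \<in> W \<Longrightarrow> z \<in> A \<longleftrightarrow> z \<bullet> \<nu> \<le> y \<bullet> \<nu>"
    by (rule flat_atE[OF assms(1)]) blast
  obtain X where X: "open X" "y \<in> X" "\<And>z. z \<in> X \<Longrightarrow> z \<in> B \<longleftrightarrow> z \<bullet> - \<nu> \<le> y \<bullet> - \<nu>"
    by (rule flat_atE[OF assms(2)]) blast
  have "W \<inter> X \<subseteq> A \<union> B"
    using W(3) X(3) by force
  then show ?thesis
    using W X by (intro interiorI[of "W \<inter> X"]) auto
qed

lemma lines_meet_at_most_once:
  fixes \<nu> \<mu> y z :: "real^2"
  assumes "norm \<nu> = 1" "norm \<mu> = 1" "\<mu> \<noteq> \<nu>" "\<mu> \<noteq> - \<nu>"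
    and "y \<bullet> \<nu> = z \<bullet> \<nu>" "y \<bullet> \<mu> = z \<bullet> \<mu>"
  shows "y = z"
proof -
  have expand: "(x \<bullet> quarter_turn \<nu>) *\<^sub>R quarter_turn \<nu> + (x \<bullet> \<nu>) *\<^sub>R \<nu> = x" for x
    using assms(1) by (intro orthonormal_expand) (auto simp: norm_quarter_turn inner_quarter_turn)
  let ?a = "(y - z) \<bullet> quarter_turn \<nu>"
  have yz: "y - z = ?a *\<^sub>R quarter_turn \<nu>"
    using expand[of "y - z"] assms(5) by (simp add: inner_diff_left)
  have "?a * (quarter_turn \<nu> \<bullet> \<mu>) = (y - z) \<bullet> \<mu>"
    by (subst (2) yz) simp
  then have "?a * (quarter_turn \<nu> \<bullet> \<mu>) = 0"
    using assms(6) by (simp add: inner_diff_left)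
  moreover have "quarter_turn \<nu> \<bullet> \<mu> \<noteq> 0"
  proof
    assume "quarter_turn \<nu> \<bullet> \<mu> = 0"
    then have \<mu>: "\<mu> = (\<mu> \<bullet> \<nu>) *\<^sub>R \<nu>"
      using expand[of \<mu>] by (simp add: inner_commute)
    then have "\<bar>\<mu> \<bullet> \<nu>\<bar> = 1"
      using assms(1,2) by (metis norm_scaleR mult.right_neutral)
    then have "\<mu> \<bullet> \<nu> = 1 \<or> \<mu> \<bullet> \<nu> = -1" by linarith
    then show False using \<mu> assms(3,4) by auto
  qed
  ultimately have "?a = 0" by simp
  then show ?thesis using yz by simp
qed

text \<open>
  The form of the condition used for induction over a finite union, where \<open>V\<close> and \<open>N\<close> grow.
\<close>

definition polygonal :: "(real^2) set \<Rightarrow> bool" where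
  "polygonal E \<longleftrightarrow> (\<exists>V N. polygonal_figure E V N)"

lemma polygonal_empty: "polygonal {}"
  unfolding polygonal_def by (intro exI[of _ "{}"]) (unfold_locales, auto)

text \<open>
  Let \<open>y\<close> be a frontier point of the union. If it belongs to only one of the two sets, that set
  determines the union near \<open>y\<close>. If it is a flat point of both, equal normals make it a flat point of
  the union, opposite normals make it an interior point, and otherwise it is one of the finitely many
  points in which a line of \<open>A\<close> meets a transversal line of \<open>B\<close>; these points join the
  exceptional set.
\<close>

lemma polygonal_Un:
  assumes "polygonal A" "polygonal B"
  shows "polygonal (A \<union> B)"
proof -
  obtain V N where "polygonal_figure A V N"
    using assms(1) by (auto simp: polygonal_def)
  then interpret A: polygonal_figure A V N .
  obtain V' N' where "polygonal_figure B V' N'"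
    using assms(2) by (auto simp: polygonal_def)
  then interpret B: polygonal_figure B V' N' .
  \<comment> \<open>The pairs of transversal lines, and below their intersection points.\<close>
  define P where "P = {(p, q) \<in> N \<times> N'. fst q \<noteq> fst p \<and> fst q \<noteq> - fst p}"
  define X where "X = (\<Union>(p, q)\<in>P. {y. y \<bullet> fst p = snd p \<and> y \<bullet> fst q = snd q})"
  have "finite X"
    unfolding X_def
  proof (rule finite_UN_I)
    show "finite P"
      using A.finite_N B.finite_N by (auto simp: P_def intro: finite_subset[of _ "N \<times> N'"])
    fix pq assume "pq \<in> P"
    then obtain p q where pq: "pq = (p, q)" "p \<in> N" "q \<in> N'" "fst q \<noteq> fst p" "fst q \<noteq> - fst p"
      by (auto simp: P_def)
    let ?Y = "{y. y \<bullet> fst p = snd p \<and> y \<bullet> fst q = snd q}"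
    have "x = y" if "x \<in> ?Y" "y \<in> ?Y" for x y
      using that pq A.unit_normal B.unit_normal by (intro lines_meet_at_most_once[of "fst p" "fst q"]) auto
    then have "finite ?Y"
      by (metis (no_types, lifting) finite.simps insertCI is_singletonI' is_singleton_def)
    then show "finite (case pq of (p, q) \<Rightarrow> {y. y \<bullet> fst p = snd p \<and> y \<bullet> fst q = snd q})"
      by (simp add: pq(1))
  qed
  have "polygonal_figure (A \<union> B) (V \<union> V' \<union> X) (N \<union> N')"
  proof
    show "compact (A \<union> B)"
      by (intro compact_Un A.compact_E B.compact_E)
    show "finite (V \<union> V' \<union> X)" "finite (N \<union> N')"
      using A.finite_V B.finite_V \<open>finite X\<close> A.finite_N B.finite_N by auto
    show "norm (fst p) = 1" if "p \<in> N \<union> N'" for p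
      using that A.unit_normal[of p] B.unit_normal[of p] by auto
    fix y assume y: "y \<in> frontier (A \<union> B)"
    show "y \<in> V \<union> V' \<union> X \<or> (\<exists>p\<in>N \<union> N'. flat_at (A \<union> B) (fst p) y \<and> y \<bullet> fst p = snd p)"
    proof (rule disjCI)
      assume no: "\<not> (\<exists>p\<in>N \<union> N'. flat_at (A \<union> B) (fst p) y \<and> y \<bullet> fst p = snd p)"
      have yAB: "y \<in> A \<or> y \<in> B"
        using y A.closed_E B.closed_E by (metis Un_iff closed_Un frontier_subset_eq in_mono)
      have "y \<notin> interior A" "y \<notin> interior B"
        using y interior_mono[of A "A \<union> B"] interior_mono[of B "A \<union> B"] by (auto simp: frontier_def)
      then have fr: "y \<in> A \<Longrightarrow> y \<in> frontier A" "y \<in> B \<Longrightarrow> y \<in> frontier B"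
        using closure_subset by (auto simp: frontier_def)
      show "y \<in> V \<union> V' \<union> X"
      proof (rule ccontr)
        assume nV: "y \<notin> V \<union> V' \<union> X"
        have inA: "\<exists>p\<in>N. flat_at A (fst p) y \<and> y \<bullet> fst p = snd p" if "y \<in> A"
          using A.frontier_flat fr that nV by blast
        have inB: "\<exists>q\<in>N'. flat_at B (fst q) y \<and> y \<bullet> fst q = snd q" if "y \<in> B"
          using B.frontier_flat fr that nV by blast
        consider "y \<in> A" "y \<notin> B" | "y \<notin> A" "y \<in> B" | "y \<in> A" "y \<in> B"
          using yAB by blast
        then show False
        proof cases
          case 1
          then show False
            using inA flat_at_Un_closed[OF _ B.closed_E] no by blast
        next
          case 2
          then show False
            using inB flat_at_Un_closed[OF _ A.closed_E] no by (metis Un_commute UnI1)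
        next
          case 3
          then obtain p q where p: "p \<in> N" "flat_at A (fst p) y" "y \<bullet> fst p = snd p"
            and q: "q \<in> N'" "flat_at B (fst q) y" "y \<bullet> fst q = snd q"
            using inA inB by blast
          have "fst q \<noteq> fst p"
            using flat_at_Un_same[OF p(2)] q(2) p no by (metis UnI1)
          moreover have "fst q \<noteq> - fst p"
            using flat_at_Un_opposite[OF p(2)] q(2) y by (auto simp: frontier_def)
          ultimately have "(p, q) \<in> P"
            using p q by (simp add: P_def)
          then have "y \<in> X"
            unfolding X_def using p(3) q(3) by (intro UN_I[of "(p, q)"]) auto
          then show False using nV by simp
        qed
      qed
    qed
  qed
  then show ?thesis by (auto simp: polygonal_def)
qed

lemma polygonal_UN:
  assumes "finite I" "\<And>i. i \<in> I \<Longrightarrow> polygonal (H i)"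
  shows "polygonal (\<Union>i\<in>I. H i)"
  using assms by (induction I) (auto intro: polygonal_empty polygonal_Un)

section \<open>Unit squares\<close>

lemma unit_squareE:
  assumes "unit_square S"
  obtains c u v where "norm u = 1" "norm v = 1" "u \<bullet> v = 0"
    "S = {z. 0 \<le> (z - c) \<bullet> u \<and> (z - c) \<bullet> u \<le> 1 \<and> 0 \<le> (z - c) \<bullet> v \<and> (z - c) \<bullet> v \<le> 1}"
proof -
  obtain c u v where uv: "norm u = 1" "norm v = 1" "u \<bullet> v = 0"
    and S: "S = {c + s *\<^sub>R u + t *\<^sub>R v | s t. 0 \<le> s \<and> s \<le> 1 \<and> 0 \<le> t \<and> t \<le> 1}"
    using assms by (auto simp: unit_square_def)
  have uv': "u \<bullet> u = 1" "v \<bullet> v = 1" "v \<bullet> u = 0"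
    using uv by (auto simp: norm_eq_1 inner_commute)
  have "S = {z. 0 \<le> (z - c) \<bullet> u \<and> (z - c) \<bullet> u \<le> 1 \<and> 0 \<le> (z - c) \<bullet> v \<and> (z - c) \<bullet> v \<le> 1}"
  proof (intro subset_antisym subsetI)
    fix z assume "z \<in> S"
    then obtain s t where st: "z = c + s *\<^sub>R u + t *\<^sub>R v" "0 \<le> s" "s \<le> 1" "0 \<le> t" "t \<le> 1"
      by (auto simp: S)
    have "(z - c) \<bullet> u = s" "(z - c) \<bullet> v = t"
      using uv uv' by (auto simp: st(1) inner_add_left inner_diff_left)
    then show "z \<in> {z. 0 \<le> (z - c) \<bullet> u \<and> (z - c) \<bullet> u \<le> 1 \<and> 0 \<le> (z - c) \<bullet> v \<and> (z - c) \<bullet> v \<le> 1}"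
      using st by simp
  next
    fix z assume z: "z \<in> {z. 0 \<le> (z - c) \<bullet> u \<and> (z - c) \<bullet> u \<le> 1 \<and> 0 \<le> (z - c) \<bullet> v \<and> (z - c) \<bullet> v \<le> 1}"
    have "z = c + ((z - c) \<bullet> u) *\<^sub>R u + ((z - c) \<bullet> v) *\<^sub>R v"
      using orthonormal_expand[OF uv, of "z - c"] by (simp add: algebra_simps)
    then show "z \<in> S" using z unfolding S by blast
  qed
  then show thesis using uv by (rule that[rotated 3])
qed

context
  fixes c u v :: "real^2" and S
  assumes uv: "norm u = 1" "norm v = 1" "u \<bullet> v = 0"
    and S: "S = {z. 0 \<le> (z - c) \<bullet> u \<and> (z - c) \<bullet> u \<le> 1 \<and> 0 \<le> (z - c) \<bullet> v \<and> (z - c) \<bullet> v \<le> 1}"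
begin

lemma square_eq_rectangle: "S = rectangle u v {c \<bullet> u..c \<bullet> u + 1} {c \<bullet> v..c \<bullet> v + 1}"
  by (auto simp: S rectangle_def inner_diff_left)

lemma square_polygonal_figure:
  "polygonal_figure S {c, c + u, c + v, c + u + v}
    {(- v, - (c \<bullet> v)), (v, c \<bullet> v + 1), (- u, - (c \<bullet> u)), (u, c \<bullet> u + 1)}"
proof
  have closed: "closed S"
    unfolding S by (intro closed_Collect_conj closed_Collect_le continuous_intros)
  moreover have "bounded S"
    unfolding square_eq_rectangle using uv by (intro bounded_rectangle) auto
  ultimately show "compact S"
    by (simp add: compact_eq_bounded_closed)
  show "norm (fst p) = 1" if "p \<in> {(- v, - (c \<bullet> v)), (v, c \<bullet> v + 1), (- u, - (c \<bullet> u)), (u, c \<bullet> u + 1)}" for p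
    using that uv by auto
  fix y assume y: "y \<in> frontier S"
  define a b where "a = (y - c) \<bullet> u" and "b = (y - c) \<bullet> v"
  have "y \<in> S" using y closed by (metis frontier_subset_eq in_mono)
  then have ab: "0 \<le> a" "a \<le> 1" "0 \<le> b" "b \<le> 1" by (auto simp: S a_def b_def)
  have y_eq: "y = c + a *\<^sub>R u + b *\<^sub>R v"
    using orthonormal_expand[OF uv, of "y - c"] by (simp add: a_def b_def algebra_simps)
  consider "0 < a" "a < 1" "0 < b" "b < 1" | "a = 0 \<or> a = 1" "b = 0 \<or> b = 1"
    | "0 < a" "a < 1" "b = 0" | "0 < a" "a < 1" "b = 1" | "0 < b" "b < 1" "a = 0" | "0 < b" "b < 1" "a = 1"
    using ab by linarith
  then show "y \<in> {c, c + u, c + v, c + u + v} \<or>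
    (\<exists>p\<in>{(- v, - (c \<bullet> v)), (v, c \<bullet> v + 1), (- u, - (c \<bullet> u)), (u, c \<bullet> u + 1)}.
      flat_at S (fst p) y \<and> y \<bullet> fst p = snd p)"
  proof cases
    case 1
    let ?W = "{z. 0 < (z - c) \<bullet> u \<and> (z - c) \<bullet> u < 1 \<and> 0 < (z - c) \<bullet> v \<and> (z - c) \<bullet> v < 1}"
    have "open ?W"
      by (intro open_Collect_conj open_Collect_less continuous_intros)
    then have "y \<in> interior S"
      using 1 by (intro interiorI[of ?W]) (auto simp: a_def b_def S)
    then show ?thesis using y by (simp add: frontier_def)
  next
    case 2
    then show ?thesis using y_eq by auto
  next
    case 3
    let ?W = "{z. 0 < (z - c) \<bullet> u \<and> (z - c) \<bullet> u < 1 \<and> (z - c) \<bullet> v < 1}"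
    have "open ?W"
      by (intro open_Collect_conj open_Collect_less continuous_intros)
    then have "flat_at S (- v) y"
      using 3 uv by (intro flat_atI[of _ ?W]) (auto simp: a_def b_def S inner_diff_left)
    then show ?thesis using 3 by (auto simp: b_def inner_diff_left)
  next
    case 4
    let ?W = "{z. 0 < (z - c) \<bullet> u \<and> (z - c) \<bullet> u < 1 \<and> 0 < (z - c) \<bullet> v}"
    have "open ?W"
      by (intro open_Collect_conj open_Collect_less continuous_intros)
    then have "flat_at S v y"
      using 4 uv by (intro flat_atI[of _ ?W]) (auto simp: a_def b_def S inner_diff_left)
    then show ?thesis using 4 by (auto simp: b_def inner_diff_left)
  next
    case 5
    let ?W = "{z. 0 < (z - c) \<bullet> v \<and> (z - c) \<bullet> v < 1 \<and> (z - c) \<bullet> u < 1}"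
    have "open ?W"
      by (intro open_Collect_conj open_Collect_less continuous_intros)
    then have "flat_at S (- u) y"
      using 5 uv by (intro flat_atI[of _ ?W]) (auto simp: a_def b_def S inner_diff_left)
    then show ?thesis using 5 by (auto simp: a_def inner_diff_left)
  next
    case 6
    let ?W = "{z. 0 < (z - c) \<bullet> v \<and> (z - c) \<bullet> v < 1 \<and> 0 < (z - c) \<bullet> u}"
    have "open ?W"
      by (intro open_Collect_conj open_Collect_less continuous_intros)
    then have "flat_at S u y"
      using 6 uv by (intro flat_atI[of _ ?W]) (auto simp: a_def b_def S inner_diff_left)
    then show ?thesis using 6 by (auto simp: a_def inner_diff_left)
  qed
qed auto

text \<open>
  Two points on the same side differ by a vector parallel to \<open>u\<close> or to \<open>v\<close>, and in that direction the
  square has width \<open>1\<close>; so the side has diameter at most \<open>1\<close>.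
\<close>

lemma measure_side_square_le:
  assumes "p \<in> {(- v, - (c \<bullet> v)), (v, c \<bullet> v + 1), (- u, - (c \<bullet> u)), (u, c \<bullet> u + 1)}"
  shows "measure lborel (side S p) \<le> 1"
proof -
  interpret polygonal_figure S "{c, c + u, c + v, c + u + v}"
    "{(- v, - (c \<bullet> v)), (v, c \<bullet> v + 1), (- u, - (c \<bullet> u)), (u, c \<bullet> u + 1)}"
    by (rule square_polygonal_figure)
  have bd: "bounded (side S p)" by (rule bounded_side[OF bounded_E])
  have "norm (s - t) \<le> 1" if "s \<in> side S p" "t \<in> side S p" for s t
  proof -
    let ?w = "on_line p s - on_line p t"
    have "on_line p s \<in> S" "on_line p t \<in> S"
      using that flat_at_mem by (auto simp: side_def)
    then have w: "\<bar>?w \<bullet> u\<bar> \<le> 1" "\<bar>?w \<bullet> v\<bar> \<le> 1"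
      by (auto simp: S inner_diff_left)
    have "?w \<bullet> fst p = 0"
      using on_line_inner(1)[OF unit_normal[OF assms]] by (simp add: inner_diff_left)
    then have "?w \<bullet> u = 0 \<or> ?w \<bullet> v = 0"
      using assms by auto
    moreover have "norm ?w \<le> \<bar>?w \<bullet> u\<bar> + \<bar>?w \<bullet> v\<bar>"
      using norm_triangle_ineq[of "(?w \<bullet> u) *\<^sub>R u" "(?w \<bullet> v) *\<^sub>R v"] uv
      by (simp add: orthonormal_expand)
    ultimately have "norm ?w \<le> 1"
      using w by auto
    then show ?thesis
      using dist_on_line[OF unit_normal[OF assms], of s t] by (simp add: dist_norm)
  qed
  then have "diameter (side S p) \<le> 1"
    by (intro diameter_le) auto
  obtain C where C: "C \<in> sets borel" "side S p \<subseteq> C" "emeasure lborel C \<le> ennreal (diameter (side S p))"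
    by (rule bounded_real_hull[OF bd])
  have "emeasure lborel (side S p) \<le> emeasure lborel C"
    using C by (intro emeasure_mono) auto
  also have "\<dots> \<le> ennreal 1"
    using C(3) \<open>diameter (side S p) \<le> 1\<close> by (meson ennreal_leI order_trans)
  finally show ?thesis
    by (simp add: measure_def enn2real_leI)
qed

lemma perimeter_square_le: "perimeter S \<le> 4"
proof -
  let ?N = "{(- v, - (c \<bullet> v)), (v, c \<bullet> v + 1), (- u, - (c \<bullet> u)), (u, c \<bullet> u + 1)}"
  interpret polygonal_figure S "{c, c + u, c + v, c + u + v}" ?N
    by (rule square_polygonal_figure)
  have "perimeter S \<le> (\<Sum>p\<in>?N. 1)"
    unfolding perimeter_eq total_side_length_def by (intro sum_mono measure_side_square_le)
  also have "\<dots> = real (card ?N)" by simp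
  also have "card ?N \<le> 4"
    using card_length[of "[(- v, - (c \<bullet> v)), (v, c \<bullet> v + 1), (- u, - (c \<bullet> u)), (u, c \<bullet> u + 1)]"] by simp
  finally show ?thesis by simp
qed

lemma area_square: "area S = 1"
  unfolding area_def square_eq_rectangle using uv by (subst measure_rectangle) auto

end

lemma
  assumes "unit_square S"
  shows polygonal_unit_square: "polygonal S" and perimeter_unit_square_le: "perimeter S \<le> 4"
    and area_unit_square: "area S = 1"
proof -
  obtain c u v where *: "norm u = 1" "norm v = 1" "u \<bullet> v = 0"
    "S = {z. 0 \<le> (z - c) \<bullet> u \<and> (z - c) \<bullet> u \<le> 1 \<and> 0 \<le> (z - c) \<bullet> v \<and> (z - c) \<bullet> v \<le> 1}"
    by (rule unit_squareE[OF assms])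
  show "polygonal S"
    unfolding polygonal_def using square_polygonal_figure[OF *] by blast
  show "perimeter S \<le> 4" "area S = 1"
    by (rule perimeter_square_le[OF *] area_square[OF *])+
qed

section \<open>Perimeters of union and intersection\<close>

lemma thicken_Un: "thicken r (A \<union> B) = thicken r A \<union> thicken r B"
  by (auto simp: thicken_def)

text \<open>
  If the intersection has perimeter \<open>p\<close>, its isoperimetric inequality says \<open>2 * sqrt (pi * area) \<le> p\<close>.
  So this is the submodularity of perimeter with the perimeter of the intersection replaced by that
  of a disc of equal area. Stated in this way it also holds if the intersection is degenerate, for
  instance if \<open>A\<close> and \<open>B\<close> share only a segment.
\<close>

theorem perimeter_Un_plus_isoperimetric_Int_le:
  assumes "polygonal A" "polygonal B"
  shows "perimeter (A \<union> B) + 2 * sqrt (pi * area (A \<inter> B)) \<le> perimeter A + perimeter B"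
proof -
  define Q where "Q X r = (area (thicken r X) - area X) / r" for X r
  have limit: "(Q X \<longlongrightarrow> perimeter X) (at_right 0)" and cpt: "compact X" if "polygonal X" for X
    using that unfolding Q_def polygonal_def
    by (auto intro: polygonal_figure.outer_minkowski_content polygonal_figure.compact_E)
  note cpt = cpt[OF assms(1)] cpt[OF assms(2)]
  have bd: "bounded A" "bounded B" "bounded (A \<inter> B)"
    using cpt by (auto intro: compact_imp_bounded bounded_subset)
  have lm: "A \<in> lmeasurable" "B \<in> lmeasurable"
    using cpt by (auto intro: lmeasurable_compact)
  have inclusion_exclusion: "area (A \<union> B) = area A + area B - area (A \<inter> B)"
    unfolding area_def by (rule measure_Un3[OF lm])
  have le: "Q (A \<union> B) r + 2 * sqrt (pi * area (A \<inter> B)) \<le> Q A r + Q B r" if r: "0 < r" for r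
  proof -
    have lmr: "thicken r X \<in> lmeasurable" if "bounded X" for X
      by (rule lmeasurable_thicken[OF that])
    have "area (thicken r (A \<union> B)) = area (thicken r A) + area (thicken r B)
        - measure lebesgue (thicken r A \<inter> thicken r B)"
      unfolding area_def thicken_Un by (rule measure_Un3[OF lmr[OF bd(1)] lmr[OF bd(2)]])
    moreover have "area (thicken r (A \<inter> B)) \<le> measure lebesgue (thicken r A \<inter> thicken r B)"
      unfolding area_def using lmr bd
      by (intro measure_mono_fmeasurable fmeasurableD fmeasurable.Int) (auto simp: thicken_def)
    moreover have "area (A \<inter> B) + r * (2 * sqrt (pi * area (A \<inter> B))) \<le> area (thicken r (A \<inter> B))"
    proof (cases "A \<inter> B = {}")
      case True
      then show ?thesis by (simp add: area_def)
    next
      case False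
      have nn: "0 \<le> area X" for X by (simp add: area_def)
      have "area (A \<inter> B) + r * (2 * sqrt (pi * area (A \<inter> B))) \<le> (sqrt (area (A \<inter> B)) + sqrt pi * r)\<^sup>2"
        using nn by (simp add: power2_sum power_mult_distrib real_sqrt_mult ac_simps)
      also have "\<dots> \<le> (sqrt (area (thicken r (A \<inter> B))))\<^sup>2"
        using sqrt_area_thicken_ge[OF compact_Int[OF cpt] False r] nn r by (intro power_mono) auto
      also have "\<dots> = area (thicken r (A \<inter> B))" using nn by simp
      finally show ?thesis .
    qed
    ultimately have "(area (thicken r (A \<union> B)) - area (A \<union> B)) + r * (2 * sqrt (pi * area (A \<inter> B)))
        \<le> (area (thicken r A) - area A) + (area (thicken r B) - area B)"
      using inclusion_exclusion by linarith
    then have "((area (thicken r (A \<union> B)) - area (A \<union> B)) + r * (2 * sqrt (pi * area (A \<inter> B)))) / r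
        \<le> ((area (thicken r A) - area A) + (area (thicken r B) - area B)) / r"
      using r by (intro divide_right_mono) auto
    then show ?thesis
      using r by (simp add: Q_def add_divide_distrib)
  qed
  have "((\<lambda>r. Q (A \<union> B) r + 2 * sqrt (pi * area (A \<inter> B))) \<longlongrightarrow>
      perimeter (A \<union> B) + 2 * sqrt (pi * area (A \<inter> B))) (at_right 0)"
    by (intro tendsto_intros limit polygonal_Un assms)
  moreover have "((\<lambda>r. Q A r + Q B r) \<longlongrightarrow> perimeter A + perimeter B) (at_right 0)"
    by (intro tendsto_intros limit assms)
  moreover have "eventually (\<lambda>r. Q (A \<union> B) r + 2 * sqrt (pi * area (A \<inter> B)) \<le> Q A r + Q B r) (at_right 0)"
    using eventually_at_right_less[of "0::real"] by eventually_elim (rule le)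
  ultimately show ?thesis
    by (intro tendsto_le[of "at_right (0::real)"]) auto
qed

theorem theorem5:
  fixes n :: nat and H :: "nat \<Rightarrow> (real^2) set"
  assumes "n \<ge> 2"
    and "\<And>i. i \<in> {1..n} \<Longrightarrow> unit_square (H i)"
    and "optimal_counterexample n H"
  shows "\<forall>i\<in>{1..n}. area (H i \<inter> (\<Union>j\<in>{1..n} - {i}. H j)) > pi / 4"
proof
  fix i assume i: "i \<in> {1..n}"
  let ?A = "\<Union>j\<in>{1..n} - {i}. H j" and ?E = "\<Union>j\<in>{1..n}. H j"
  let ?c = "area (?A \<inter> H i)"
  have E: "?E = ?A \<union> H i" using i by auto
  have poly: "polygonal ?A" "polygonal (H i)"
    by (rule polygonal_UN, simp_all add: assms(2) polygonal_unit_square)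
      (rule polygonal_unit_square[OF assms(2)[OF i]])
  have lm: "X \<in> lmeasurable" if "polygonal X" for X
    using that by (auto simp: polygonal_def intro: lmeasurable_compact polygonal_figure.compact_E)
  have inclusion_exclusion: "area ?E = area ?A + area (H i) - ?c"
    unfolding E area_def by (intro measure_Un3 lm poly)
  have square: "perimeter (H i) \<le> 4" "area (H i) = 1"
    using assms(2)[OF i] by (rule perimeter_unit_square_le area_unit_square)+
  have "(if i = 1 then 2 else 1) \<in> {1..n} - {i}"
    using assms(1) i by auto
  then obtain j where j: "j \<in> {1..n} - {i}" by blast
  then have "1 \<le> area ?A"
  proof -
    have "unit_square (H j)" using assms(2) j by simp
    then have "area (H j) = 1" "H j \<in> lmeasurable"
      by (auto intro: area_unit_square lm polygonal_unit_square)
    moreover have "measure lebesgue (H j) \<le> measure lebesgue ?A"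
      using j calculation(2) by (intro measure_mono_fmeasurable lm poly) auto
    ultimately show ?thesis by (simp add: area_def)
  qed
  have ratio: "perimeter ?E / area ?E > 4" "perimeter ?A / area ?A \<le> 4"
    using assms(3) i by (auto simp: optimal_counterexample_def)
  have "area ?E \<noteq> 0"
    using ratio(1) by (metis div_by_0 not_numeral_less_zero)
  then have "0 < area ?E"
    by (simp add: area_def less_le)
  then have p: "4 * area ?E < perimeter ?E" "perimeter ?A \<le> 4 * area ?A"
    using ratio \<open>1 \<le> area ?A\<close> by (simp_all only: pos_less_divide_eq pos_divide_le_eq)
  have "perimeter ?E + 2 * sqrt (pi * ?c) \<le> perimeter ?A + perimeter (H i)"
    unfolding E by (rule perimeter_Un_plus_isoperimetric_Int_le[OF poly])
  then have "sqrt (pi * ?c) < 2 * ?c"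
    using p square inclusion_exclusion by linarith
  moreover have nn: "0 \<le> ?c" by (simp add: area_def)
  ultimately have "(sqrt (pi * ?c))\<^sup>2 < (2 * ?c)\<^sup>2"
    by (intro power_strict_mono) auto
  also have "(sqrt (pi * ?c))\<^sup>2 = pi * ?c"
    using nn by simp
  finally have "?c * pi < ?c * (4 * ?c)"
    by (simp add: power2_eq_square mult.commute)
  then have "pi < 4 * ?c"
    using nn by (simp add: mult_less_cancel_left)
  then show "area (H i \<inter> ?A) > pi / 4"
    by (simp add: Int_commute)
qed

end
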